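(* The elements $\mathbf{P}^{\pi}$, where $\pi$ runs over the set of signed non-decreasing parking functions (nondecreasing parking functions together with a color $0$ or $1$ chosen for each prime factor), form a basis of a cocommutative Hopf subalgebra $\mathbf{NCPQSym}^{(2)}$ of the Hopf algebra $\mathbf{PQSym}^{(2)}$ (with structure maps in the $\mathbf{F}$ basis).
   Context: A parking function of length $n$ is a word $\mathbf{a}=a_1\cdots a_n$ on $\{1,\ldots,n\}$ whose nondecreasing rearrangement $a_1'\cdots a_n'$ satisfies $a_i'\le i$. It is prime if the only $b\in\{1,\dots,n\}$ with $|\{i:a_i\le b\}|=b$ is $b=n$. The shifted concatenation of words is $v\bullet v'=v\cdot v'[k]$, $k=|v|$, where $v'[k]$ is $v'$ with $k$ added to each letter. Every nondecreasing parking function factors uniquely as a maximal shifted concatenation of prime nondecreasing parking functions; choosing a color in $\{0,1\}$ for each factor and giving this color to all the letters of the factor, one obtains the colored words $\pi$ (there are $\binom{2n}{n}$ of them of length $n$, identified with type $B$ non-crossing partitions). A $2$-colored parking function is a pair $(\mathbf{a},u)$ of a parking function and a word $u$ of the same length on $\{0,1\}$. The $\mathbf{F}_{(\mathbf{a},u)}$ form a basis of a graded Hopf algebra with $$\mathbf{F}_{(\mathbf{a}',u')}\mathbf{F}_{(\mathbf{a}'',u'')}=\sum_{(\mathbf{a},u)\in(\mathbf{a}',u')\Cup(\mathbf{a}'',u'')}\mathbf{F}_{(\mathbf{a},u)},\qquad \Delta\mathbf{F}_{(\mathbf{a},u)}=\sum_{p'p''=\mathbf{a},\ u'u''=u,\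 |p'|=|u'|}\mathbf{F}_{(\mathrm{Park}(p'),u')}\otimes\mathbf{F}_{(\mathrm{Park}(p''),u'')}.$$ Here $(\mathbf{a}',u')\Cup(\mathbf{a}'',u'')$ is the shifted shuffle: the shuffle of the words of biletters $(\mathbf{a}',u')$ and $(\mathbf{a}''[k],u'')$, $k=|\mathbf{a}'|$ (colors follow their letters). $\mathrm{Park}$ is the parkization: for a word $w$ of length $n$ of positive integers, let $d(w)=\min\{i:\#\{j:w_j\le i\}<i\}$; if $d(w)=n+1$ then $\mathrm{Park}(w)=w$; otherwise $\mathrm{Park}(w)=\mathrm{Park}(w')$ where $w'$ is obtained by decreasing by $1$ all letters of $w$ greater than $d(w)$. For $\pi$ a colored word obtained from a nondecreasing parking function by choosing a color in $\{0,1\}$ for each factor of its maximal factorization into prime nondecreasing parking functions and giving this color to all the letters of the factor, $$\mathbf{P}^{\pi}=\sum_{(\mathbf{a},u)^{\uparrow}=\pi}\mathbf{F}_{(\mathbf{a},u)},$$ where $w^\uparrow$ denotes the nondecreasing rearrangement of the letters of the colored word $w$ (each letter keeping its color); i.e. the sum is over all distinct rearrangements of the colored word $\pi$. *)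

theory Defs
  imports Complex_Main "HOL-Library.Multiset" "HOL-Library.Poly_Mapping"
begin

section \<open>Free vector spaces\<close>

text \<open>
  A vector space with a chosen basis indexed by the type \<open>'a\<close> is the type \<open>'a \<Rightarrow>\<^sub>0 'k\<close> of finitely
  supported functions; the basis vector of index \<open>a\<close> is \<open>Poly_Mapping.single a 1\<close>. The tensor
  product of \<open>'a \<Rightarrow>\<^sub>0 'k\<close> and \<open>'b \<Rightarrow>\<^sub>0 'k\<close> is \<open>'a \<times> 'b \<Rightarrow>\<^sub>0 'k\<close>. The product that the library puts on
  poly mappings is not used.
\<close>

abbreviation bvec :: "'a \<Rightarrow> ('a \<Rightarrow>\<^sub>0 'k::field)" where
  "bvec a \<equiv> Poly_Mapping.single a 1"

definition fscale :: "'k::field \<Rightarrow> ('a \<Rightarrow>\<^sub>0 'k) \<Rightarrow> ('a \<Rightarrow>\<^sub>0 'k)" where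
  "fscale c = Poly_Mapping.map ((*) c)"

lemma lookup_fscale: "Poly_Mapping.lookup (fscale c x) a = c * Poly_Mapping.lookup x a"
  by (simp add: fscale_def Poly_Mapping.map.rep_eq when_def)

global_interpretation free_vs: vector_space "fscale :: 'k::field \<Rightarrow> ('a \<Rightarrow>\<^sub>0 'k) \<Rightarrow> ('a \<Rightarrow>\<^sub>0 'k)"
  by unfold_locales (rule poly_mapping_eqI; simp add: lookup_fscale lookup_add algebra_simps)+

definition lin_ext :: "('a \<Rightarrow> ('b \<Rightarrow>\<^sub>0 'k::field)) \<Rightarrow> ('a \<Rightarrow>\<^sub>0 'k) \<Rightarrow> ('b \<Rightarrow>\<^sub>0 'k)" where
  "lin_ext f x = (\<Sum>a\<in>Poly_Mapping.keys x. fscale (Poly_Mapping.lookup x a) (f a))"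

definition tensor :: "('a \<Rightarrow>\<^sub>0 'k::field) \<Rightarrow> ('b \<Rightarrow>\<^sub>0 'k) \<Rightarrow> ('a \<times> 'b \<Rightarrow>\<^sub>0 'k)" where
  "tensor x y = lin_ext (\<lambda>a. lin_ext (\<lambda>b. bvec (a, b)) y) x"

definition tensor_map :: "(('a \<Rightarrow>\<^sub>0 'k::field) \<Rightarrow> ('c \<Rightarrow>\<^sub>0 'k)) \<Rightarrow> (('b \<Rightarrow>\<^sub>0 'k) \<Rightarrow> ('d \<Rightarrow>\<^sub>0 'k)) \<Rightarrow>
    ('a \<times> 'b \<Rightarrow>\<^sub>0 'k) \<Rightarrow> ('c \<times> 'd \<Rightarrow>\<^sub>0 'k)" where
  "tensor_map f g = lin_ext (\<lambda>(a, b). tensor (f (bvec a)) (g (bvec b)))"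

definition twist :: "('a \<times> 'b \<Rightarrow>\<^sub>0 'k::field) \<Rightarrow> ('b \<times> 'a \<Rightarrow>\<^sub>0 'k)" where
  "twist = lin_ext (\<lambda>(a, b). bvec (b, a))"

definition tensor_assoc :: "(('a \<times> 'b) \<times> 'c \<Rightarrow>\<^sub>0 'k::field) \<Rightarrow> ('a \<times> 'b \<times> 'c \<Rightarrow>\<^sub>0 'k)" where
  "tensor_assoc = lin_ext (\<lambda>((a, b), c). bvec (a, b, c))"

definition middle_swap ::
    "(('a \<times> 'b) \<times> ('c \<times> 'd) \<Rightarrow>\<^sub>0 'k::field) \<Rightarrow> (('a \<times> 'c) \<times> ('b \<times> 'd) \<Rightarrow>\<^sub>0 'k)" where
  "middle_swap = lin_ext (\<lambda>((a, b), (c, d)). bvec ((a, c), (b, d)))"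

section \<open>Hopf algebras\<close>

locale hopf_algebra =
  fixes m :: "('a \<times> 'a \<Rightarrow>\<^sub>0 'k::field) \<Rightarrow> ('a \<Rightarrow>\<^sub>0 'k)"
    and one :: "'a \<Rightarrow>\<^sub>0 'k"
    and \<Delta> :: "('a \<Rightarrow>\<^sub>0 'k) \<Rightarrow> ('a \<times> 'a \<Rightarrow>\<^sub>0 'k)"
    and \<epsilon> :: "('a \<Rightarrow>\<^sub>0 'k) \<Rightarrow> 'k"
    and S :: "('a \<Rightarrow>\<^sub>0 'k) \<Rightarrow> ('a \<Rightarrow>\<^sub>0 'k)"
  assumes linear_m: "Vector_Spaces.linear fscale fscale m"
    and linear_\<Delta>: "Vector_Spaces.linear fscale fscale \<Delta>"
    and linear_\<epsilon>: "Vector_Spaces.linear fscale (*) \<epsilon>"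
    and linear_S: "Vector_Spaces.linear fscale fscale S"
    and assoc: "m (tensor (m (tensor x y)) z) = m (tensor x (m (tensor y z)))"
    and unit_left: "m (tensor one x) = x"
    and unit_right: "m (tensor x one) = x"
    and coassoc: "tensor_assoc (tensor_map \<Delta> id (\<Delta> x)) = tensor_map id \<Delta> (\<Delta> x)"
    and counit_left: "lin_ext (\<lambda>(a, b). fscale (\<epsilon> (bvec a)) (bvec b)) (\<Delta> x) = x"
    and counit_right: "lin_ext (\<lambda>(a, b). fscale (\<epsilon> (bvec b)) (bvec a)) (\<Delta> x) = x"
    and \<Delta>_mult: "\<Delta> (m (tensor x y)) = tensor_map m m (middle_swap (tensor (\<Delta> x) (\<Delta> y)))"
    and \<Delta>_one: "\<Delta> one = tensor one one"
    and \<epsilon>_mult: "\<epsilon> (m (tensor x y)) = \<epsilon> x * \<epsilon> y"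
    and \<epsilon>_one: "\<epsilon> one = 1"
    and antipode_left: "m (tensor_map S id (\<Delta> x)) = fscale (\<epsilon> x) one"
    and antipode_right: "m (tensor_map id S (\<Delta> x)) = fscale (\<epsilon> x) one"

definition hopf_subalgebra ::
    "(('a \<times> 'a \<Rightarrow>\<^sub>0 'k::field) \<Rightarrow> ('a \<Rightarrow>\<^sub>0 'k)) \<Rightarrow> ('a \<Rightarrow>\<^sub>0 'k) \<Rightarrow>
     (('a \<Rightarrow>\<^sub>0 'k) \<Rightarrow> ('a \<times> 'a \<Rightarrow>\<^sub>0 'k)) \<Rightarrow> (('a \<Rightarrow>\<^sub>0 'k) \<Rightarrow> 'k) \<Rightarrow>
     (('a \<Rightarrow>\<^sub>0 'k) \<Rightarrow> ('a \<Rightarrow>\<^sub>0 'k)) \<Rightarrow> ('a \<Rightarrow>\<^sub>0 'k) set \<Rightarrow> bool" where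
  "hopf_subalgebra m one \<Delta> \<epsilon> S H \<longleftrightarrow>
     hopf_algebra m one \<Delta> \<epsilon> S \<and>
     module.subspace fscale H \<and>
     one \<in> H \<and>
     (\<forall>x\<in>H. \<forall>y\<in>H. m (tensor x y) \<in> H) \<and>
     (\<forall>x\<in>H. \<Delta> x \<in> module.span fscale {tensor y z |y z. y \<in> H \<and> z \<in> H}) \<and>
     (\<forall>x\<in>H. S x \<in> H)"

definition cocommutative_on ::
    "(('a \<Rightarrow>\<^sub>0 'k::field) \<Rightarrow> ('a \<times> 'a \<Rightarrow>\<^sub>0 'k)) \<Rightarrow> ('a \<Rightarrow>\<^sub>0 'k) set \<Rightarrow> bool" where
  "cocommutative_on \<Delta> H \<longleftrightarrow> (\<forall>x\<in>H. twist (\<Delta> x) = \<Delta> x)"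

section \<open>Parking functions and parkization\<close>

definition parking :: "nat list \<Rightarrow> bool" where
  "parking a \<longleftrightarrow> set a \<subseteq> {1..length a} \<and> (\<forall>i<length a. sort a ! i \<le> Suc i)"

text \<open>The empty word is not prime: there the set on the left-hand side is empty.\<close>

definition prime_parking :: "nat list \<Rightarrow> bool" where
  "prime_parking a \<longleftrightarrow> parking a \<and>
     {b \<in> {1..length a}. card {i. i < length a \<and> a ! i \<le> b} = b} = {length a}"

definition park_defect :: "nat list \<Rightarrow> nat" where
  "park_defect w = (LEAST i. card {j. j < length w \<and> w ! j \<le> i} < i)"

lemma park_defect_less: "card {j. j < length w \<and> w ! j \<le> park_defect w} < park_defect w"
proof -
  have "card {j. j < length w \<and> w ! j \<le> Suc (length w)} \<le> card {..<length w}"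
    by (rule card_mono) auto
  then have "card {j. j < length w \<and> w ! j \<le> Suc (length w)} < Suc (length w)"
    by simp
  then show ?thesis
    unfolding park_defect_def by (rule LeastI)
qed

lemma park_defect_le: "park_defect w \<le> Suc (length w)"
proof -
  have "card {j. j < length w \<and> w ! j \<le> Suc (length w)} \<le> card {..<length w}"
    by (rule card_mono) auto
  then have "card {j. j < length w \<and> w ! j \<le> Suc (length w)} < Suc (length w)"
    by simp
  then show ?thesis
    unfolding park_defect_def by (rule Least_le)
qed

definition park_step :: "nat list \<Rightarrow> nat list" where
  "park_step w = map (\<lambda>x. if x > park_defect w then x - 1 else x) w"

lemma length_park_step [simp]: "length (park_step w) = length w"
  by (simp add: park_step_def)

lemma sum_list_park_step:
  assumes "park_defect w \<noteq> Suc (length w)"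
  shows "sum_list (park_step w) < sum_list w"
proof -
  let ?d = "park_defect w"
  have "\<exists>x\<in>set w. ?d < x"
  proof (rule ccontr)
    assume "\<not> ?thesis"
    then have "\<And>j. j < length w \<Longrightarrow> w ! j \<le> ?d"
      by (meson leI nth_mem)
    then have "{j. j < length w \<and> w ! j \<le> ?d} = {..<length w}"
      by auto
    then show False
      using park_defect_less[of w] park_defect_le[of w] assms by simp
  qed
  moreover have "(\<exists>x\<in>set v. ?d < x) \<Longrightarrow>
      sum_list (map (\<lambda>x. if x > ?d then x - 1 else x) v) < sum_list v" for v
  proof (induction v)
    case (Cons x v)
    have le: "sum_list (map (\<lambda>x. if x > ?d then x - 1 else x) v) \<le> sum_list v"
      by (induction v) auto
    show ?case
    proof (cases "\<exists>x\<in>set v. ?d < x")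
      case True
      then show ?thesis using Cons.IH by auto
    next
      case False
      then have "?d < x" using Cons.prems by auto
      then show ?thesis using le by auto
    qed
  qed simp
  ultimately show ?thesis
    by (simp add: park_step_def)
qed

function parkization :: "nat list \<Rightarrow> nat list" where
  "parkization w = (if park_defect w = Suc (length w) then w else parkization (park_step w))"
  by auto
termination
  by (relation "measure sum_list") (auto intro: sum_list_park_step)

declare parkization.simps [simp del]

lemma length_parkization [simp]: "length (parkization w) = length w"
  by (induction w rule: parkization.induct) (subst parkization.simps, simp)

lemma card_le_conv_size_filter_mset:
  "card {j. j < length a \<and> a ! j \<le> i} = size (filter_mset (\<lambda>x. x \<le> i) (mset a))"
  for a :: "nat list"
proof -
  have "size (filter_mset (\<lambda>x. x \<le> i) (mset a)) = length (filter (\<lambda>x. x \<le> i) a)"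
    by (simp only: mset_filter[symmetric] size_mset)
  then show ?thesis by (simp only: length_filter_conv_card)
qed

lemma parking_iff:
  "parking a \<longleftrightarrow>
     0 \<notin> set a \<and> (\<forall>i\<le>length a. i \<le> card {j. j < length a \<and> a ! j \<le> i})"
proof -
  have count: "card {j. j < length a \<and> a ! j \<le> i} = card {j. j < length a \<and> sort a ! j \<le> i}" for i
    using card_le_conv_size_filter_mset[of "sort a" i] card_le_conv_size_filter_mset[of a i]
    by simp
  have mono: "sort a ! j \<le> sort a ! k" if "j \<le> k" "k < length a" for j k
    using that by (simp add: sorted_nth_mono)
  show ?thesis
  proof
    assume p: "parking a"
    have "i \<le> card {j. j < length a \<and> a ! j \<le> i}" if "i \<le> length a" for i
    proof -
      have "{..<i} \<subseteq> {j. j < length a \<and> sort a ! j \<le> i}"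
      proof
        fix j assume "j \<in> {..<i}"
        then have "j < length a" "Suc j \<le> i" using that by auto
        moreover have "sort a ! j \<le> Suc j"
          using p \<open>j < length a\<close> by (simp add: parking_def)
        ultimately show "j \<in> {j. j < length a \<and> sort a ! j \<le> i}" by simp
      qed
      from card_mono[OF _ this] show ?thesis by (simp add: count)
    qed
    then show "0 \<notin> set a \<and> (\<forall>i\<le>length a. i \<le> card {j. j < length a \<and> a ! j \<le> i})"
      using p by (auto simp: parking_def)
  next
    assume r: "0 \<notin> set a \<and> (\<forall>i\<le>length a. i \<le> card {j. j < length a \<and> a ! j \<le> i})"
    have s: "sort a ! i \<le> Suc i" if i: "i < length a" for i
    proof (rule ccontr)
      assume n: "\<not> ?thesis"
      have "{j. j < length a \<and> sort a ! j \<le> Suc i} \<subseteq> {..<i}"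
      proof
        fix j assume "j \<in> {j. j < length a \<and> sort a ! j \<le> Suc i}"
        then have j: "j < length a" "sort a ! j \<le> Suc i" by auto
        have "\<not> i \<le> j" using mono[of i j] j n by linarith
        then show "j \<in> {..<i}" by simp
      qed
      from card_mono[OF _ this] have "card {j. j < length a \<and> a ! j \<le> Suc i} \<le> i"
        by (simp add: count)
      moreover have "Suc i \<le> card {j. j < length a \<and> a ! j \<le> Suc i}"
        using r i by simp
      ultimately show False by simp
    qed
    have "x \<in> {1..length a}" if "x \<in> set a" for x
    proof -
      from that have "x \<in> set (sort a)" by simp
      then obtain i where "i < length a" "x = sort a ! i"
        by (metis in_set_conv_nth length_sort)
      then have "x \<le> length a" using s[of i] by simp
      moreover have "x \<noteq> 0" using r that by metis
      ultimately show ?thesis by simp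
    qed
    then have "set a \<subseteq> {1..length a}" by (rule subsetI)
    then show "parking a" using s unfolding parking_def by blast
  qed
qed

lemma parking_parkization:
  assumes "0 \<notin> set w"
  shows "parking (parkization w)"
  using assms
proof (induction w rule: parkization.induct)
  case (1 w)
  show ?case
  proof (cases "park_defect w = Suc (length w)")
    case True
    then have "parkization w = w" by (simp add: parkization.simps)
    moreover have "i \<le> card {j. j < length w \<and> w ! j \<le> i}" if "i \<le> length w" for i
      using not_less_Least[of i "\<lambda>i. card {j. j < length w \<and> w ! j \<le> i} < i"] that True
      by (simp add: park_defect_def)
    ultimately show ?thesis using "1.prems" by (simp add: parking_iff)
  next
    case False
    have "0 < park_defect w" using park_defect_less[of w] by simp
    then have "0 \<notin> set (park_step w)"
      using "1.prems" by (auto simp: park_step_def split: if_splits)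
    with "1.IH"[OF False] False show ?thesis
      by (simp add: parkization.simps[of w])
  qed
qed

section \<open>Colored words\<close>

text \<open>
  The colored word \<open>(a, u)\<close> is encoded as the list of its biletters, so that \<open>a\<close> is \<open>map fst w\<close> and
  \<open>u\<close> is \<open>map snd w\<close>. The colors \<open>0\<close> and \<open>1\<close> are \<open>False\<close> and \<open>True\<close>.
\<close>

type_synonym colored_word = "(nat \<times> bool) list"

definition shift :: "nat \<Rightarrow> colored_word \<Rightarrow> colored_word" where
  "shift k w = map (\<lambda>(x, c). (x + k, c)) w"

definition colored_park :: "colored_word \<Rightarrow> colored_word" where
  "colored_park w = zip (parkization (map fst w)) (map snd w)"

lemma parking_colored_park:
  assumes "parking (map fst w)" "set v \<subseteq> set w"
  shows "parking (map fst (colored_park v))"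
proof -
  have "0 \<notin> set (map fst v)"
    using assms unfolding parking_iff by auto
  then show ?thesis
    by (simp add: colored_park_def parking_parkization)
qed

typedef colored_pf = "{w :: colored_word. parking (map fst w)}"
  by (rule exI[of _ "[]"]) (simp add: parking_def)

setup_lifting type_definition_colored_pf

lift_definition empty_pf :: colored_pf is "[]"
  by (simp add: parking_def)

lift_definition park_take :: "nat \<Rightarrow> colored_pf \<Rightarrow> colored_pf" is
  "\<lambda>i w. colored_park (take i w)"
  by (auto intro: parking_colored_park dest: in_set_takeD)

lift_definition park_drop :: "nat \<Rightarrow> colored_pf \<Rightarrow> colored_pf" is
  "\<lambda>i w. colored_park (drop i w)"
  by (auto intro: parking_colored_park dest: in_set_dropD)

definition shifted_shuffle :: "colored_word \<Rightarrow> colored_word \<Rightarrow> colored_word set" where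
  "shifted_shuffle v w = shuffles v (shift (length v) w)"

lemma parking_shifted_shuffle:
  assumes "parking (map fst v)" "parking (map fst w)" "z \<in> shifted_shuffle v w"
  shows "parking (map fst z)"
proof -
  let ?k = "length v" and ?l = "length w"
  have perm: "mset z = mset v + mset (shift ?k w)"
    using assms(3) by (auto simp: shifted_shuffle_def dest: mset_shuffles)
  have len: "length z = ?k + ?l"
    using arg_cong[OF perm, of size] by (simp add: shift_def)
  note cnt = card_le_conv_size_filter_mset
  have split: "mset (map fst z) = mset (map fst v) + mset (map (\<lambda>x. x + ?k) (map fst w))"
  proof -
    have "map fst (shift ?k w) = map (\<lambda>x. x + ?k) (map fst w)"
      by (auto simp: shift_def)
    then have "image_mset fst (mset (shift ?k w)) = mset (map (\<lambda>x. x + ?k) (map fst w))"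
      by (simp only: mset_map[symmetric])
    then show ?thesis by (simp only: mset_map[of fst] perm image_mset_union)
  qed
  have shifted: "size (filter_mset (\<lambda>x. x \<le> i) (mset (map (\<lambda>x. x + ?k) b)))
      = size (filter_mset (\<lambda>x. x \<le> i - ?k) (mset b))" if "?k \<le> i" for b :: "nat list" and i
    using that by (induction b) (auto simp: le_diff_conv2)
  have nz: "0 \<notin> set (map fst z)"
  proof -
    have "set (map fst z) = set (map fst v) \<union> set (map (\<lambda>x. x + ?k) (map fst w))"
      using arg_cong[OF split, of set_mset] by simp
    moreover have "0 \<notin> set (map fst v)" "0 \<notin> set (map fst w)"
      using assms(1,2) unfolding parking_iff by auto
    moreover have "0 \<notin> set (map (\<lambda>x. x + ?k) b)" if "0 \<notin> set b" for b :: "nat list"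
      using that by (induction b) auto
    ultimately show ?thesis by blast
  qed
  let ?N = "\<lambda>i a. size (filter_mset (\<lambda>x. x \<le> i) (mset a))"
  have pv: "i \<le> ?N i (map fst v)" if "i \<le> ?k" for i
    using assms(1)[unfolded parking_iff cnt, unfolded length_map] that by blast
  have pw: "i \<le> ?N i (map fst w)" if "i \<le> ?l" for i
    using assms(2)[unfolded parking_iff cnt, unfolded length_map] that by blast
  have sum: "?N i (map fst z) = ?N i (map fst v) + ?N i (map (\<lambda>x. x + ?k) (map fst w))" for i
    by (simp only: split filter_union_mset size_union)
  have "i \<le> ?N i (map fst z)" if i: "i \<le> ?k + ?l" for i
  proof (cases "i \<le> ?k")
    case True
    then show ?thesis using pv[of i] sum[of i] by linarith
  next
    case False
    have "set (map fst v) \<subseteq> {1..?k}"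
      using assms(1) unfolding parking_def length_map by (rule conjunct1)
    then have "\<forall>x\<in>set (map fst v). x \<le> i"
      using False by (meson atLeastAtMost_iff le_trans nat_le_linear subsetD)
    then have "filter (\<lambda>x. x \<le> i) (map fst v) = map fst v"
      by (intro filter_True)
    then have "?N i (map fst v) = ?k"
      by (simp only: mset_filter[symmetric] size_mset length_map)
    moreover have "i - ?k \<le> ?N (i - ?k) (map fst w)"
      using pw[of "i - ?k"] i by linarith
    ultimately show ?thesis
      using shifted[of i "map fst w"] sum[of i] False by linarith
  qed
  then have "\<forall>i\<le>length (map fst z). i \<le> card {j. j < length (map fst z) \<and> map fst z ! j \<le> i}"
    unfolding cnt unfolding length_map len by blast
  with nz show ?thesis unfolding parking_iff by blast
qed

section \<open>The Hopf algebra of 2-colored parking functions\<close>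

text \<open>
  \<open>PQSym^(2)\<close> is the type \<open>colored_pf \<Rightarrow>\<^sub>0 'k\<close>, and \<open>bvec w\<close> is the basis element \<open>F\<^sub>w\<close>.
\<close>

text \<open>
  The letters of the two shuffled words are disjoint, so every shuffle occurs exactly once and the
  sum over the set of shuffles is the sum with multiplicities. By \<open>parking_shifted_shuffle\<close> all
  members of that set are colored parking functions.
\<close>

definition PQ_mult :: "(colored_pf \<times> colored_pf \<Rightarrow>\<^sub>0 'k::field) \<Rightarrow> (colored_pf \<Rightarrow>\<^sub>0 'k)" where
  "PQ_mult = lin_ext (\<lambda>(v, w).
     \<Sum>z | Rep_colored_pf z \<in> shifted_shuffle (Rep_colored_pf v) (Rep_colored_pf w). bvec z)"

text \<open>The unit is \<open>F\<close> of the empty word and the counit is its coefficient.\<close>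

definition PQ_one :: "colored_pf \<Rightarrow>\<^sub>0 'k::field" where
  "PQ_one = bvec empty_pf"

definition PQ_comult :: "(colored_pf \<Rightarrow>\<^sub>0 'k::field) \<Rightarrow> (colored_pf \<times> colored_pf \<Rightarrow>\<^sub>0 'k)" where
  "PQ_comult = lin_ext (\<lambda>w.
     \<Sum>i = 0..length (Rep_colored_pf w). tensor (bvec (park_take i w)) (bvec (park_drop i w)))"

definition PQ_counit :: "(colored_pf \<Rightarrow>\<^sub>0 'k::field) \<Rightarrow> 'k" where
  "PQ_counit x = Poly_Mapping.lookup x empty_pf"

section \<open>Signed nondecreasing parking functions\<close>

fun shifted_concat :: "colored_word list \<Rightarrow> colored_word" where
  "shifted_concat [] = []"
| "shifted_concat (v # vs) = v @ shift (length v) (shifted_concat vs)"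

text \<open>
  The factorization of a nondecreasing parking function into prime nondecreasing parking functions
  is unique, so coloring the factors of all nondecreasing parking functions amounts to taking all
  shifted concatenations of monochromatic prime nondecreasing parking functions.
\<close>

definition signed_ndpf :: "colored_word set" where
  "signed_ndpf =
     {shifted_concat (map (\<lambda>(a, c). map (\<lambda>x. (x, c)) a) fs) |fs :: (nat list \<times> bool) list.
        \<forall>(a, c) \<in> set fs. prime_parking a \<and> sorted a}"

text \<open>
  The rearrangement \<open>w\<^sup>\<up>\<close> is the stable one. How it orders equal letters of different colors is
  irrelevant below, since all occurrences of a letter in a signed nondecreasing parking function
  have the same color.
\<close>

definition nondec :: "colored_word \<Rightarrow> colored_word" where
  "nondec w = sort_key fst w"

definition PP :: "colored_word \<Rightarrow> (colored_pf \<Rightarrow>\<^sub>0 'k::field)" where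
  "PP \<pi> = (\<Sum>w | nondec (Rep_colored_pf w) = \<pi>. bvec w)"

definition NCPQSym2 :: "(colored_pf \<Rightarrow>\<^sub>0 'k::field) set" where
  "NCPQSym2 = module.span fscale (PP ` signed_ndpf)"

end

theory Submission
  imports Defs "HOL-Combinatorics.Permutations"
begin

text \<open>
  Parkization relabels the letters of a word by a function that depends only on the multiset of
  letters (\<open>relabel\<close>). A coefficient of a product is obtained by cutting a word at a breakpoint \<open>k\<close>
  (exactly \<open>k\<close> letters are at most \<open>k\<close>) into its small and its large letters, and breakpoints survive
  in the parkizations of all subwords; together these facts give the bialgebra axioms. The antipode
  is the geometric series of the convolution algebra.

  A parking function is a rearrangement of a signed nondecreasing one iff any two letters of
  different colors are separated by a breakpoint (\<open>signed\<close>). Hence the span of the \<open>P\<^sup>\<pi>\<close> consists of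
  the elements whose coefficients vanish outside these words and are invariant under permutations of
  the letters; in this form the closure properties and cocommutativity are visible on coefficients.
\<close>

section \<open>Linear maps between free vector spaces\<close>

text \<open>Breakpoints are the places where the nondecreasing rearrangement factors, so coloring
  its prime factors means that the color may change only across a breakpoint. The coproduct
  threatens this: a subword has gaps, parkization closes them, and letters of different colors might
  end up in one factor. The parking inequality excludes it. Between \<open>y\<close> and a
  breakpoint \<open>k\<close> lie at most \<open>k - y\<close> letters, so in a subword no interval
  ending at \<open>k\<close> is overcrowded either, and the number of its letters up to
  \<open>k\<close> is again a breakpoint after parkization.

  Parkization is a recursion that removes one empty position at a time. Parkizing a piece of a
  parkized word must agree with parkizing the piece directly, and the recursion hides this, since
  the piece and the whole word have different defects. Hence the closed form for the label of a
  letter, which is shown to be invariant under each single step of the larger word.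

  No formula for the antipode on the \<open>P\<close> basis is required: every term of the geometric
  series is built from unit, counit, product and coproduct.\<close>

abbreviation flinear :: "(('a \<Rightarrow>\<^sub>0 'k::field) \<Rightarrow> ('b \<Rightarrow>\<^sub>0 'k)) \<Rightarrow> bool" where
  "flinear \<equiv> Vector_Spaces.linear fscale fscale"

lemma flinear_iff:
  "flinear f \<longleftrightarrow> (\<forall>x y. f (x + y) = f x + f y) \<and> (\<forall>c x. f (fscale c x) = fscale c (f x))"
  by (simp add: Vector_Spaces.linear_iff free_vs.vector_space_axioms)

lemma flinearI:
  assumes "\<And>x y. f (x + y) = f x + f y" "\<And>c x. f (fscale c x) = fscale c (f x)"
  shows "flinear f"
  using assms by (simp add: flinear_iff)

lemma
  assumes "flinear f"
  shows flinear_add: "f (x + y) = f x + f y"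
    and flinear_scale: "f (fscale c x) = fscale c (f x)"
    and flinear_0: "f 0 = 0"
    and flinear_diff: "f (x - y) = f x - f y"
    and flinear_sum: "f (sum h A) = (\<Sum>a\<in>A. f (h a))"
proof -
  interpret Vector_Spaces.linear fscale fscale f by fact
  show "f (x + y) = f x + f y" "f (fscale c x) = fscale c (f x)" "f 0 = 0"
    "f (x - y) = f x - f y" "f (sum h A) = (\<Sum>a\<in>A. f (h a))"
    by (rule add scale zero diff sum)+
qed

lemma flinear_id [simp]: "flinear (\<lambda>x. x)" "flinear id"
  by (auto intro!: flinearI)

lemma flinear_compose: "flinear f \<Longrightarrow> flinear g \<Longrightarrow> flinear (\<lambda>x. f (g x))"
  by (simp add: flinear_iff)

lemma flinear_minus: "flinear f \<Longrightarrow> flinear g \<Longrightarrow> flinear (\<lambda>x. f x - g x)"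
  by (simp add: flinear_iff free_vs.scale_right_diff_distrib algebra_simps)

lemma lookup_lin_ext:
  "Poly_Mapping.lookup (lin_ext f x) b =
     (\<Sum>a\<in>Poly_Mapping.keys x. Poly_Mapping.lookup x a * Poly_Mapping.lookup (f a) b)"
  by (simp add: lin_ext_def lookup_sum lookup_fscale)

text \<open>Cancellation can make the keys of \<open>x + y\<close> smaller than those of the
  summands, so linearity is checked over a common finite index set.\<close>

lemma lin_ext_superset:
  assumes "finite A" "Poly_Mapping.keys x \<subseteq> A"
  shows "lin_ext f x = (\<Sum>a\<in>A. fscale (Poly_Mapping.lookup x a) (f a))"
  unfolding lin_ext_def
  by (rule sum.mono_neutral_left) (use assms in \<open>auto simp: in_keys_iff\<close>)

lemma flinear_lin_ext [simp]: "flinear (lin_ext f)" for f :: "'a \<Rightarrow> ('b \<Rightarrow>\<^sub>0 'k::field)"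
proof (rule flinearI)
  fix x y :: "'a \<Rightarrow>\<^sub>0 'k"
  let ?A = "Poly_Mapping.keys x \<union> Poly_Mapping.keys y"
  have "Poly_Mapping.keys (x + y) \<subseteq> ?A" by (rule keys_add)
  then show "lin_ext f (x + y) = lin_ext f x + lin_ext f y"
    by (simp add: lin_ext_superset[of ?A] lookup_add free_vs.scale_left_distrib sum.distrib)
next
  fix c and x :: "'a \<Rightarrow>\<^sub>0 'k"
  have "Poly_Mapping.keys (fscale c x) \<subseteq> Poly_Mapping.keys x"
    by (auto simp: in_keys_iff lookup_fscale)
  then show "lin_ext f (fscale c x) = fscale c (lin_ext f x)"
    by (simp add: lin_ext_superset[of "Poly_Mapping.keys x"] lookup_fscale free_vs.scale_sum_right)
qed

lemma lin_ext_bvec [simp]: "lin_ext f (bvec a) = f a"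
  by (simp add: lin_ext_def)

lemma lin_ext_expand: "lin_ext bvec x = x"
proof (rule poly_mapping_eqI)
  fix k
  show "Poly_Mapping.lookup (lin_ext bvec x) k = Poly_Mapping.lookup x k"
    by (simp add: lookup_lin_ext lookup_single when_def in_keys_iff if_distrib cong: if_cong)
qed

lemma flinear_eq_lin_ext:
  assumes "flinear f"
  shows "f x = lin_ext (\<lambda>a. f (bvec a)) x"
proof -
  have "f x = f (lin_ext bvec x)" by (simp add: lin_ext_expand)
  then show ?thesis
    by (simp add: lin_ext_def flinear_sum[OF assms] flinear_scale[OF assms])
qed

lemma flinear_eqI:
  assumes "flinear f" "flinear g" "\<And>a. f (bvec a) = g (bvec a)"
  shows "f x = g x"
  using flinear_eq_lin_ext[OF assms(1), of x] flinear_eq_lin_ext[OF assms(2), of x] assms(3)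
  by simp

section \<open>Tensor products of vectors and of linear maps\<close>

lemma lookup_tensor [simp]:
  "Poly_Mapping.lookup (tensor x y) (a, b) = Poly_Mapping.lookup x a * Poly_Mapping.lookup y b"
proof -
  have eq: "Poly_Mapping.lookup (lin_ext (\<lambda>b. bvec (c, b)) y) (a, b) =
      (if c = a then Poly_Mapping.lookup y b else 0)" for c
    by (simp add: lookup_lin_ext lookup_single when_def in_keys_iff if_distrib cong: if_cong)
  show ?thesis
    unfolding tensor_def lookup_lin_ext[of _ x] eq
    by (simp add: in_keys_iff if_distrib cong: if_cong)
qed

lemma flinear_tensor_left: "flinear (\<lambda>x. tensor x y)"
  and flinear_tensor_right: "flinear (tensor x)"
  by (rule flinearI; rule poly_mapping_eqI;
      auto simp: lookup_add lookup_fscale algebra_simps)+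

lemma flinear_tensor [simp]:
  "flinear f \<Longrightarrow> flinear (\<lambda>z. tensor (f z) y)" "flinear g \<Longrightarrow> flinear (\<lambda>z. tensor x (g z))"
  by (rule flinear_compose[OF flinear_tensor_left], assumption)
    (rule flinear_compose[OF flinear_tensor_right])

lemma flinear_lin_ext_compose [simp]: "flinear h \<Longrightarrow> flinear (\<lambda>x. lin_ext f (h x))"
  by (rule flinear_compose[OF flinear_lin_ext])

lemma tensor_bvec [simp]: "tensor (bvec a) (bvec b) = bvec (a, b)"
  by (simp add: tensor_def)

lemma bilinear_eqI:
  assumes "\<And>y. flinear (\<lambda>x. f x y)" "\<And>y. flinear (\<lambda>x. g x y)"
    and "\<And>x. flinear (f x)" "\<And>x. flinear (g x)"
    and "\<And>a b. f (bvec a) (bvec b) = g (bvec a) (bvec b)"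
  shows "f x y = g x y"
proof -
  have "f (bvec a) y = g (bvec a) y" for a
    by (rule flinear_eqI[OF assms(3,4,5)])
  then show ?thesis
    by (rule flinear_eqI[OF assms(1,2)])
qed

lemma flinear_tensor_map [simp]: "flinear (tensor_map f g)"
  by (simp add: tensor_map_def)

lemma tensor_map_bvec: "tensor_map f g (bvec (a, b)) = tensor (f (bvec a)) (g (bvec b))"
  by (simp add: tensor_map_def)

lemma flinear_tensor_map_compose [simp]: "flinear h \<Longrightarrow> flinear (\<lambda>x. tensor_map f g (h x))"
  by (rule flinear_compose[OF flinear_tensor_map])

lemma tensor_map_tensor:
  assumes "flinear f" "flinear g"
  shows "tensor_map f g (tensor x y) = tensor (f x) (g y)"
  by (rule bilinear_eqI[of "\<lambda>x y. tensor_map f g (tensor x y)" "\<lambda>x y. tensor (f x) (g y)"])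
    (simp_all add: tensor_map_bvec assms)

lemma tensor_map_compose:
  assumes "flinear f" "flinear g"
  shows "tensor_map f g (tensor_map f' g' x) = tensor_map (\<lambda>x. f (f' x)) (\<lambda>x. g (g' x)) x"
proof (rule flinear_eqI[of "\<lambda>x. tensor_map f g (tensor_map f' g' x)"])
  fix p
  show "tensor_map f g (tensor_map f' g' (bvec p)) =
      tensor_map (\<lambda>x. f (f' x)) (\<lambda>x. g (g' x)) (bvec p)"
    by (cases p) (simp add: tensor_map_bvec tensor_map_tensor assms)
qed simp_all

lemma flinear_tensor_assoc [simp]: "flinear tensor_assoc"
  by (simp add: tensor_assoc_def)

lemma flinear_tensor_assoc_compose [simp]: "flinear h \<Longrightarrow> flinear (\<lambda>x. tensor_assoc (h x))"
  by (rule flinear_compose[OF flinear_tensor_assoc])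

lemma tensor_assoc_tensor: "tensor_assoc (tensor (tensor x y) z) = tensor x (tensor y z)"
proof -
  have bvec: "tensor_assoc (tensor (tensor x y) (bvec c)) = tensor x (tensor y (bvec c))" for c
  proof (rule bilinear_eqI[of "\<lambda>x y. tensor_assoc (tensor (tensor x y) (bvec c))"
        "\<lambda>x y. tensor x (tensor y (bvec c))"])
    show "tensor_assoc (tensor (tensor (bvec a) (bvec b)) (bvec c)) =
        tensor (bvec a) (tensor (bvec b) (bvec c))" for a b
      by (simp add: tensor_assoc_def)
  qed simp_all
  show ?thesis
    by (rule flinear_eqI[of "\<lambda>z. tensor_assoc (tensor (tensor x y) z)"
          "\<lambda>z. tensor x (tensor y z)"]) (simp_all add: bvec)
qed

lemma tensor_assoc_tensor_map:
  assumes "flinear f" "flinear g" "flinear h"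
  shows "tensor_assoc (tensor_map (tensor_map f g) h x) =
    tensor_map f (tensor_map g h) (tensor_assoc x)"
proof (rule flinear_eqI[of "\<lambda>x. tensor_assoc (tensor_map (tensor_map f g) h x)"
      "\<lambda>x. tensor_map f (tensor_map g h) (tensor_assoc x)"])
  show "tensor_assoc (tensor_map (tensor_map f g) h (bvec a)) =
      tensor_map f (tensor_map g h) (tensor_assoc (bvec a))" for a
  proof -
    obtain p q r where a: "a = ((p, q), r)" by (metis prod.exhaust)
    show ?thesis
      by (simp add: a tensor_map_bvec tensor_assoc_tensor)
        (simp add: tensor_assoc_def tensor_map_bvec)
  qed
qed simp_all

text \<open>Only the tensors of the images have to agree, and only on pairs that occur in
  \<open>x\<close>. So one vanishing factor kills a term, and in a graded coproduct the two maps
  matter only up to a bounded degree.\<close>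

lemma tensor_map_cong:
  assumes "\<And>a b. (a, b) \<in> Poly_Mapping.keys x \<Longrightarrow>
    tensor (f (bvec a)) (g (bvec b)) = tensor (f' (bvec a)) (g' (bvec b))"
  shows "tensor_map f g x = tensor_map f' g' x"
  unfolding tensor_map_def lin_ext_def using assms by (intro sum.cong) auto

lemma tensor_map_plus_left: "tensor_map (\<lambda>x. f x + f' x) g y = tensor_map f g y + tensor_map f' g y"
  by (simp add: tensor_map_def lin_ext_def case_prod_beta flinear_add[OF flinear_tensor_left]
      free_vs.scale_right_distrib sum.distrib)

lemma tensor_map_plus_right: "tensor_map g (\<lambda>x. f x + f' x) y = tensor_map g f y + tensor_map g f' y"
  by (simp add: tensor_map_def lin_ext_def case_prod_beta flinear_add[OF flinear_tensor_right]
      free_vs.scale_right_distrib sum.distrib)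

lemma tensor_map_minus_left: "tensor_map (\<lambda>x. f x - f' x) g y = tensor_map f g y - tensor_map f' g y"
  by (simp add: tensor_map_def lin_ext_def case_prod_beta flinear_diff[OF flinear_tensor_left]
      free_vs.scale_right_diff_distrib sum_subtractf)

lemma tensor_map_minus_right: "tensor_map g (\<lambda>x. f x - f' x) y = tensor_map g f y - tensor_map g f' y"
  by (simp add: tensor_map_def lin_ext_def case_prod_beta flinear_diff[OF flinear_tensor_right]
      free_vs.scale_right_diff_distrib sum_subtractf)

section \<open>The antipode of a connected graded bialgebra\<close>

text \<open>\<open>graded\<close> and \<open>connected\<close> make the geometric series finite on
  each basis element: the coproduct distributes the degree over its two factors, and a basis element
  of degree \<open>0\<close> is the unit.\<close>

locale connected_bialgebra =
  fixes m :: "('a \<times> 'a \<Rightarrow>\<^sub>0 'k::field) \<Rightarrow> ('a \<Rightarrow>\<^sub>0 'k)"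
    and one :: "'a \<Rightarrow>\<^sub>0 'k"
    and \<Delta> :: "('a \<Rightarrow>\<^sub>0 'k) \<Rightarrow> ('a \<times> 'a \<Rightarrow>\<^sub>0 'k)"
    and \<epsilon> :: "('a \<Rightarrow>\<^sub>0 'k) \<Rightarrow> 'k"
    and deg :: "'a \<Rightarrow> nat"
  assumes linear_m: "flinear m"
    and linear_\<Delta>: "flinear \<Delta>"
    and linear_\<epsilon>: "Vector_Spaces.linear fscale (*) \<epsilon>"
    and assoc: "m (tensor (m (tensor x y)) z) = m (tensor x (m (tensor y z)))"
    and unit_left: "m (tensor one x) = x"
    and unit_right: "m (tensor x one) = x"
    and coassoc: "tensor_assoc (tensor_map \<Delta> id (\<Delta> x)) = tensor_map id \<Delta> (\<Delta> x)"
    and counit_left: "lin_ext (\<lambda>(a, b). fscale (\<epsilon> (bvec a)) (bvec b)) (\<Delta> x) = x"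
    and counit_right: "lin_ext (\<lambda>(a, b). fscale (\<epsilon> (bvec b)) (bvec a)) (\<Delta> x) = x"
    and \<epsilon>_one: "\<epsilon> one = 1"
    and graded: "(a, b) \<in> Poly_Mapping.keys (\<Delta> (bvec c)) \<Longrightarrow> deg a + deg b = deg c"
    and connected: "deg a = 0 \<Longrightarrow> bvec a = one"
begin

definition conv :: "(('a \<Rightarrow>\<^sub>0 'k) \<Rightarrow> ('a \<Rightarrow>\<^sub>0 'k)) \<Rightarrow> (('a \<Rightarrow>\<^sub>0 'k) \<Rightarrow> ('a \<Rightarrow>\<^sub>0 'k)) \<Rightarrow>
    ('a \<Rightarrow>\<^sub>0 'k) \<Rightarrow> ('a \<Rightarrow>\<^sub>0 'k)" where
  "conv f g x = m (tensor_map f g (\<Delta> x))"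

definition conv_one :: "('a \<Rightarrow>\<^sub>0 'k) \<Rightarrow> ('a \<Rightarrow>\<^sub>0 'k)" where
  "conv_one x = fscale (\<epsilon> x) one"

definition aug :: "('a \<Rightarrow>\<^sub>0 'k) \<Rightarrow> ('a \<Rightarrow>\<^sub>0 'k)" where
  "aug x = conv_one x - x"

fun aug_power :: "nat \<Rightarrow> ('a \<Rightarrow>\<^sub>0 'k) \<Rightarrow> ('a \<Rightarrow>\<^sub>0 'k)" where
  "aug_power 0 = conv_one"
| "aug_power (Suc n) = conv aug (aug_power n)"

text \<open>The geometric series for the convolution inverse of \<open>id = conv_one - aug\<close>; \<open>aug\<close> vanishes in
  degree \<open>0\<close>, so the terms of index greater than the degree contribute nothing.\<close>

definition antipode :: "('a \<Rightarrow>\<^sub>0 'k) \<Rightarrow> ('a \<Rightarrow>\<^sub>0 'k)" where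
  "antipode = lin_ext (\<lambda>a. \<Sum>n\<le>deg a. aug_power n (bvec a))"

section \<open>The convolution algebra of linear maps\<close>

lemma flinear_m_compose [simp]: "flinear h \<Longrightarrow> flinear (\<lambda>x. m (h x))"
  by (rule flinear_compose[OF linear_m])

lemma flinear_conv: "flinear (conv f g)"
  unfolding conv_def by (simp add: linear_\<Delta>)

lemma flinear_conv_one: "flinear conv_one"
proof -
  interpret \<epsilon>: Vector_Spaces.linear fscale "(*)" \<epsilon> by (rule linear_\<epsilon>)
  show ?thesis
    by (rule flinearI) (simp_all add: conv_one_def \<epsilon>.add \<epsilon>.scale free_vs.scale_left_distrib)
qed

lemma flinear_aug: "flinear aug"
  unfolding aug_def by (intro flinear_minus flinear_conv_one flinear_id)

lemma flinear_aug_power: "flinear (aug_power n)"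
  by (cases n) (simp_all add: flinear_conv flinear_conv_one)

text \<open>Both bracketings are expressed through the threefold coproduct; associativity of
  \<open>m\<close> carries the product across \<open>tensor_assoc\<close>, and coassociativity does
  the same for the coproduct.\<close>

lemma conv_assoc:
  assumes "flinear f" "flinear g" "flinear h"
  shows "conv (conv f g) h x = conv f (conv g h) x"
proof -
  have conv: "conv f g = (\<lambda>x. m (tensor_map f g (\<Delta> x)))" for f g
    by (simp add: conv_def fun_eq_iff)
  have "conv (conv f g) h x = m (tensor_map m (\<lambda>x. x) (tensor_map (tensor_map f g) h
      (tensor_map \<Delta> id (\<Delta> x))))"
    by (simp add: conv tensor_map_compose linear_m assms)
  also have "\<dots> = m (tensor_map (\<lambda>x. x) m (tensor_assoc (tensor_map (tensor_map f g) h
      (tensor_map \<Delta> id (\<Delta> x)))))"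
  proof (rule flinear_eqI[of "\<lambda>y. m (tensor_map m (\<lambda>x. x) y)"
        "\<lambda>y. m (tensor_map (\<lambda>x. x) m (tensor_assoc y))"])
    fix a :: "('a \<times> 'a) \<times> 'a"
    obtain p q r where a: "a = ((p, q), r)" by (metis prod.exhaust)
    show "m (tensor_map m (\<lambda>x. x) (bvec a)) = m (tensor_map (\<lambda>x. x) m (tensor_assoc (bvec a)))"
      using assoc[of "bvec p" "bvec q" "bvec r"]
      by (simp add: a tensor_map_bvec tensor_assoc_def)
  qed simp_all
  also have "\<dots> = m (tensor_map (\<lambda>x. x) m (tensor_map f (tensor_map g h)
      (tensor_assoc (tensor_map \<Delta> id (\<Delta> x)))))"
    by (simp add: tensor_assoc_tensor_map assms)
  also have "\<dots> = conv f (conv g h) x"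
    by (simp add: coassoc conv tensor_map_compose linear_m assms)
  finally show ?thesis .
qed

lemma conv_one_left:
  assumes "flinear f"
  shows "conv conv_one f x = f x"
proof -
  have "m (tensor_map conv_one f y) =
      f (lin_ext (\<lambda>(a, b). fscale (\<epsilon> (bvec a)) (bvec b)) y)" for y
  proof (rule flinear_eqI[of "\<lambda>y. m (tensor_map conv_one f y)"])
    fix p :: "'a \<times> 'a"
    show "m (tensor_map conv_one f (bvec p)) =
        f (lin_ext (\<lambda>(a, b). fscale (\<epsilon> (bvec a)) (bvec b)) (bvec p))"
      by (cases p) (simp add: tensor_map_bvec conv_one_def flinear_scale[OF flinear_tensor_left]
          flinear_scale[OF linear_m] flinear_scale[OF assms] unit_left)
  qed (simp_all add: flinear_compose[OF assms])
  then show ?thesis by (simp add: conv_def counit_left)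
qed

lemma conv_one_right:
  assumes "flinear f"
  shows "conv f conv_one x = f x"
proof -
  have "m (tensor_map f conv_one y) =
      f (lin_ext (\<lambda>(a, b). fscale (\<epsilon> (bvec b)) (bvec a)) y)" for y
  proof (rule flinear_eqI[of "\<lambda>y. m (tensor_map f conv_one y)"])
    fix p :: "'a \<times> 'a"
    show "m (tensor_map f conv_one (bvec p)) =
        f (lin_ext (\<lambda>(a, b). fscale (\<epsilon> (bvec b)) (bvec a)) (bvec p))"
      by (cases p) (simp add: tensor_map_bvec conv_one_def flinear_scale[OF flinear_tensor_right]
          flinear_scale[OF linear_m] flinear_scale[OF assms] unit_right)
  qed (simp_all add: flinear_compose[OF assms])
  then show ?thesis by (simp add: conv_def counit_right)
qed

lemmas conv_distribs =
  tensor_map_plus_left tensor_map_plus_right tensor_map_minus_left tensor_map_minus_right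
  flinear_add[OF linear_m] flinear_diff[OF linear_m]

lemma id_eq_conv_one_minus_aug: "id = (\<lambda>x. conv_one x - aug x)"
  by (simp add: aug_def fun_eq_iff)

lemma conv_aug_power_id:
  "conv (aug_power n) id x = aug_power n x - aug_power (Suc n) x"
  "conv id (aug_power n) x = aug_power n x - aug_power (Suc n) x"
proof -
  \<comment> \<open>The powers are built by multiplying with \<open>aug\<close> on the left. The
    telescope for \<open>conv (aug_power n) id\<close> produces \<open>aug\<close> on the right, so
    the two have to commute.\<close>
  have comm: "conv (aug_power n) aug x = conv aug (aug_power n) x" for n x
  proof (induction n arbitrary: x)
    case 0
    then show ?case by (simp add: conv_one_left conv_one_right flinear_aug)
  next
    case (Suc n)
    have eq: "conv (aug_power n) aug = conv aug (aug_power n)" using Suc by auto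
    show ?case
      by (simp add: conv_assoc flinear_aug flinear_aug_power eq)
  qed
  have "conv (aug_power n) id x = conv (aug_power n) conv_one x - conv (aug_power n) aug x"
    by (subst id_eq_conv_one_minus_aug) (simp add: conv_def conv_distribs)
  then show "conv (aug_power n) id x = aug_power n x - aug_power (Suc n) x"
    by (simp add: comm conv_one_right flinear_aug_power)
  have "conv id (aug_power n) x = conv conv_one (aug_power n) x - conv aug (aug_power n) x"
    by (subst id_eq_conv_one_minus_aug) (simp add: conv_def conv_distribs)
  then show "conv id (aug_power n) x = aug_power n x - aug_power (Suc n) x"
    by (simp add: conv_one_left flinear_aug_power)
qed

lemma aug_eq_0: "deg a = 0 \<Longrightarrow> aug (bvec a) = 0"
  by (simp add: connected aug_def conv_one_def \<epsilon>_one)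

text \<open>In each term of the coproduct either the left factor has degree \<open>0\<close>, where
  \<open>aug\<close> vanishes, or the right factor has smaller degree than \<open>a\<close> and the
  induction hypothesis for one power less applies.\<close>

lemma aug_power_eq_0: "deg a < n \<Longrightarrow> aug_power n (bvec a) = 0"
proof (induction n arbitrary: a)
  case (Suc n)
  have "tensor_map aug (aug_power n) (\<Delta> (bvec a)) = tensor_map (\<lambda>_. 0) (\<lambda>_. 0) (\<Delta> (bvec a))"
  proof (rule tensor_map_cong)
    fix p q assume "(p, q) \<in> Poly_Mapping.keys (\<Delta> (bvec a))"
    then have "deg p + deg q = deg a" by (rule graded)
    then have "deg p = 0 \<or> deg q < n" using Suc.prems by linarith
    then show "tensor (aug (bvec p)) (aug_power n (bvec q)) = tensor 0 0"
      using aug_eq_0 Suc.IH by (auto simp: flinear_0 flinear_tensor_left flinear_tensor_right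
          flinear_0[OF flinear_tensor_left])
  qed
  also have "\<dots> = 0"
    by (simp add: tensor_map_def lin_ext_def case_prod_beta flinear_0[OF flinear_tensor_right])
  finally show ?case by (simp add: conv_def flinear_0[OF linear_m])
qed simp

lemma antipode_bvec:
  assumes "deg a \<le> N"
  shows "antipode (bvec a) = (\<Sum>n\<le>N. aug_power n (bvec a))"
  unfolding antipode_def lin_ext_bvec
  by (rule sum.mono_neutral_left) (use assms in \<open>auto intro: aug_power_eq_0\<close>)

lemma flinear_antipode: "flinear antipode"
  by (simp add: antipode_def)

text \<open>All factors in the coproduct of a basis element of degree \<open>d\<close> have degree
  at most \<open>d\<close>. On them \<open>antipode\<close> agrees with the partial sum up to
  \<open>d\<close>, whose telescope leaves only a power that vanishes in degree
  \<open>d\<close>.\<close>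

lemma antipode_conv_id:
  "conv antipode id x = conv_one x" "conv id antipode x = conv_one x"
proof -
  have telescope: "conv (\<lambda>x. \<Sum>n\<le>N. aug_power n x) id x = conv_one x - aug_power (Suc N) x"
    "conv id (\<lambda>x. \<Sum>n\<le>N. aug_power n x) x = conv_one x - aug_power (Suc N) x" for N x
  proof (induction N)
    case 0
    show "conv (\<lambda>x. \<Sum>n\<le>0. aug_power n x) id x = conv_one x - aug_power (Suc 0) x"
      "conv id (\<lambda>x. \<Sum>n\<le>0. aug_power n x) x = conv_one x - aug_power (Suc 0) x"
      using conv_aug_power_id[of 0 x] by simp_all
  next
    case (Suc N)
    have split: "conv (\<lambda>x. \<Sum>n\<le>Suc N. aug_power n x) id x =
        conv (\<lambda>x. \<Sum>n\<le>N. aug_power n x) id x + conv (aug_power (Suc N)) id x"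
      "conv id (\<lambda>x. \<Sum>n\<le>Suc N. aug_power n x) x =
        conv id (\<lambda>x. \<Sum>n\<le>N. aug_power n x) x + conv id (aug_power (Suc N)) x"
      unfolding sum.atMost_Suc by (simp_all add: conv_def conv_distribs del: aug_power.simps)
    show "conv (\<lambda>x. \<Sum>n\<le>Suc N. aug_power n x) id x = conv_one x - aug_power (Suc (Suc N)) x"
      "conv id (\<lambda>x. \<Sum>n\<le>Suc N. aug_power n x) x = conv_one x - aug_power (Suc (Suc N)) x"
      unfolding split Suc.IH conv_aug_power_id by (simp_all del: aug_power.simps)
  qed
  have eq: "antipode (bvec b) = (\<Sum>n\<le>deg a. aug_power n (bvec b))"
    if "deg b \<le> deg a" for a b
    using that by (rule antipode_bvec)
  have deg: "deg p \<le> deg a \<and> deg q \<le> deg a" if "(p, q) \<in> Poly_Mapping.keys (\<Delta> (bvec a))" for p q a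
    using graded[OF that] by linarith
  have "conv antipode id (bvec a) = conv_one (bvec a)" for a
  proof -
    have "conv antipode id (bvec a) = conv (\<lambda>x. \<Sum>n\<le>deg a. aug_power n x) id (bvec a)"
      unfolding conv_def by (rule arg_cong[of _ _ m], rule tensor_map_cong) (use deg eq in metis)
    then show ?thesis using aug_power_eq_0[of a "Suc (deg a)"] by (simp only: telescope) simp
  qed
  then show "conv antipode id x = conv_one x"
    using flinear_eqI[OF flinear_conv flinear_conv_one] by blast
  have "conv id antipode (bvec a) = conv_one (bvec a)" for a
  proof -
    have "conv id antipode (bvec a) = conv id (\<lambda>x. \<Sum>n\<le>deg a. aug_power n x) (bvec a)"
      unfolding conv_def by (rule arg_cong[of _ _ m], rule tensor_map_cong) (use deg eq in metis)
    then show ?thesis using aug_power_eq_0[of a "Suc (deg a)"] by (simp only: telescope) simp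
  qed
  then show "conv id antipode x = conv_one x"
    using flinear_eqI[OF flinear_conv flinear_conv_one] by blast
qed

text \<open>The antipode is defined on basis elements, which need not lie in \<open>H\<close>. Since
  \<open>x\<close> involves finitely many degrees, one truncation serves its whole expansion, and
  \<open>antipode x\<close> becomes a sum of convolution powers evaluated at \<open>x\<close>
  itself; these stay in \<open>H\<close>.\<close>

lemma antipode_mem:
  assumes H: "module.subspace fscale H"
    and "one \<in> H" "\<And>x y. x \<in> H \<Longrightarrow> y \<in> H \<Longrightarrow> m (tensor x y) \<in> H"
    and \<Delta>: "\<And>x. x \<in> H \<Longrightarrow> \<Delta> x \<in> module.span fscale {tensor y z |y z. y \<in> H \<and> z \<in> H}"
    and "x \<in> H"
  shows "antipode x \<in> H"
proof -
  have aug: "aug y \<in> H" "conv_one y \<in> H" if "y \<in> H" for y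
    unfolding aug_def conv_one_def using assms that
    by (auto intro!: free_vs.subspace_diff[OF H] free_vs.subspace_scale[OF H])
  have conv: "conv f g y \<in> H"
    if "flinear f" "flinear g" "\<And>y. y \<in> H \<Longrightarrow> f y \<in> H" "\<And>y. y \<in> H \<Longrightarrow> g y \<in> H" "y \<in> H" for f g y
  proof -
    have "m (tensor_map f g u) \<in> H"
      if "u \<in> module.span fscale {tensor y z |y z. y \<in> H \<and> z \<in> H}" for u
      using that
    proof (induction u rule: free_vs.span_induct_alt)
      case base
      show ?case
        using free_vs.subspace_0[OF H] by (simp add: flinear_0[OF flinear_tensor_map] flinear_0[OF linear_m])
    next
      case (step c u v)
      then obtain y z where "u = tensor y z" "y \<in> H" "z \<in> H" by blast
      then have "m (tensor_map f g u) \<in> H"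
        using assms that by (simp add: tensor_map_tensor \<open>flinear f\<close> \<open>flinear g\<close> \<open>\<And>y. y \<in> H \<Longrightarrow> f y \<in> H\<close>
          \<open>\<And>y. y \<in> H \<Longrightarrow> g y \<in> H\<close>)
      then show ?case
        using step free_vs.subspace_add[OF H] free_vs.subspace_scale[OF H]
        by (simp add: flinear_add[OF flinear_tensor_map] flinear_scale[OF flinear_tensor_map]
            flinear_add[OF linear_m] flinear_scale[OF linear_m])
    qed
    with \<Delta>[OF \<open>y \<in> H\<close>] show ?thesis by (simp add: conv_def)
  qed
  have power: "aug_power n y \<in> H" if "y \<in> H" for n y
    using that
    by (induction n arbitrary: y) (auto intro!: aug conv flinear_aug flinear_aug_power)
  \<comment> \<open>Inserting \<open>0\<close> keeps the maximum defined for
    \<open>x = 0\<close>.\<close>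
  define N where "N = Max (insert 0 (deg ` Poly_Mapping.keys x))"
  have "antipode x = (\<Sum>a\<in>Poly_Mapping.keys x. fscale (Poly_Mapping.lookup x a)
      (\<Sum>n\<le>N. aug_power n (bvec a)))"
    unfolding flinear_eq_lin_ext[OF flinear_antipode, of x] lin_ext_def
    by (rule sum.cong) (auto simp: N_def intro!: antipode_bvec)
  also have "\<dots> = (\<Sum>n\<le>N. lin_ext (\<lambda>a. aug_power n (bvec a)) x)"
    unfolding lin_ext_def free_vs.scale_sum_right by (rule sum.swap)
  also have "\<dots> = (\<Sum>n\<le>N. aug_power n x)"
    by (simp only: flinear_eq_lin_ext[OF flinear_aug_power, of _ x, symmetric])
  also have "\<dots> \<in> H"
    by (intro free_vs.subspace_sum[OF H] power \<open>x \<in> H\<close>)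
  finally show ?thesis .
qed

end

section \<open>Sums over the fibres of a map\<close>

text \<open>\<open>r\<close> picks a representative of each fibre. The abstract form serves twice:
  for the \<open>P\<close> basis, and for its tensor square with \<open>r\<close> acting on both
  components.\<close>

lemma span_fibre_sums:
  fixes PP' :: "'a \<Rightarrow> ('a \<Rightarrow>\<^sub>0 'k::field)"
  assumes PP': "\<And>p w. p \<in> G \<Longrightarrow> Poly_Mapping.lookup (PP' p) w = (if r w = p then 1 else 0)"
    and r: "\<And>p. p \<in> G \<Longrightarrow> r p = p"
  shows "module.span fscale (PP' ` G) = {x. \<forall>w. Poly_Mapping.lookup x w =
    (if r w \<in> G then Poly_Mapping.lookup x (r w) else 0)}" (is "_ = ?H")
proof
  have "free_vs.subspace ?H"
    by (rule free_vs.subspaceI) (auto simp: lookup_add lookup_fscale)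
  moreover have "PP' ` G \<subseteq> ?H"
    by (auto simp: PP' r)
  ultimately show "free_vs.span (PP' ` G) \<subseteq> ?H"
    by (rule free_vs.span_minimal[rotated])
next
  show "?H \<subseteq> free_vs.span (PP' ` G)"
  proof
    fix x assume x: "x \<in> ?H"
    let ?K = "Poly_Mapping.keys x \<inter> G"
    \<comment> \<open>The coordinates are the coefficients at the representatives: \<open>w\<close>
      lies only in the fibre over \<open>r w\<close>, so at most one summand contributes to its
      coefficient.\<close>
    have "x = (\<Sum>p\<in>?K. fscale (Poly_Mapping.lookup x p) (PP' p))"
    proof (rule poly_mapping_eqI)
      fix w
      have "Poly_Mapping.lookup (\<Sum>p\<in>?K. fscale (Poly_Mapping.lookup x p) (PP' p)) w =
          (\<Sum>p\<in>?K. if r w = p then Poly_Mapping.lookup x p else 0)"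
        unfolding lookup_sum lookup_fscale by (rule sum.cong) (auto simp: PP')
      also have "\<dots> = (if r w \<in> ?K then Poly_Mapping.lookup x (r w) else 0)"
        by simp
      also have "\<dots> = (if r w \<in> G then Poly_Mapping.lookup x (r w) else 0)"
        by (auto simp: in_keys_iff)
      also have "\<dots> = Poly_Mapping.lookup x w"
        using x by simp
      finally show "Poly_Mapping.lookup x w =
          Poly_Mapping.lookup (\<Sum>p\<in>?K. fscale (Poly_Mapping.lookup x p) (PP' p)) w" ..
    qed
    also have "\<dots> \<in> free_vs.span (PP' ` G)"
      by (intro free_vs.span_sum free_vs.span_scale free_vs.span_base) auto
    finally show "x \<in> free_vs.span (PP' ` G)" .
  qed
qed

text \<open>Distinct fibres are disjoint and \<open>p\<close> lies in its own, so the coefficient at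
  \<open>p\<close> isolates the summand of index \<open>p\<close>.\<close>

lemma independent_fibre_sums:
  fixes PP' :: "'a \<Rightarrow> ('a \<Rightarrow>\<^sub>0 'k::field)"
  assumes PP': "\<And>p w. p \<in> G \<Longrightarrow> Poly_Mapping.lookup (PP' p) w = (if r w = p then 1 else 0)"
    and r: "\<And>p. p \<in> G \<Longrightarrow> r p = p"
  shows "inj_on PP' G" "\<not> module.dependent fscale (PP' ` G)"
proof -
  show inj: "inj_on PP' G"
  proof (rule inj_onI)
    fix p q assume "p \<in> G" "q \<in> G" "PP' p = PP' q"
    then have "Poly_Mapping.lookup (PP' p) p = Poly_Mapping.lookup (PP' q) p" by simp
    then show "p = q" using \<open>p \<in> G\<close> \<open>q \<in> G\<close> by (simp add: PP' r split: if_splits)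
  qed
  show "\<not> module.dependent fscale (PP' ` G)"
  proof
    assume "free_vs.dependent (PP' ` G)"
    then obtain T u v where T: "finite T" "T \<subseteq> PP' ` G" "(\<Sum>v\<in>T. fscale (u v) v) = 0"
      "v \<in> T" "u v \<noteq> 0"
      unfolding free_vs.dependent_explicit by blast
    obtain A where A: "A \<subseteq> G" "T = PP' ` A"
      using T(2) by (auto simp: subset_image_iff)
    have injA: "inj_on PP' A" using inj A(1) by (rule inj_on_subset)
    have fin: "finite A" using T(1) A(2) injA by (simp add: finite_image_iff)
    obtain p where p: "p \<in> A" "v = PP' p" using T(4) A(2) by auto
    have "0 = Poly_Mapping.lookup (\<Sum>q\<in>A. fscale (u (PP' q)) (PP' q)) p"
      using T(3) injA by (simp add: A(2) sum.reindex)
    also have "\<dots> = (\<Sum>q\<in>A. if q = p then u (PP' q) else 0)"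
      unfolding lookup_sum lookup_fscale using A(1) p(1)
      by (intro sum.cong) (auto simp: PP' r subset_iff)
    also have "\<dots> = u v" using fin p by simp
    finally show False using T(5) by simp
  qed
qed

section \<open>Parkization as a relabelling\<close>

definition cnt :: "nat list \<Rightarrow> nat \<Rightarrow> nat" where
  "cnt a k = length (filter (\<lambda>x. x \<le> k) a)"

lemma cnt_conv_card: "cnt a k = card {j. j < length a \<and> a ! j \<le> k}"
  by (simp add: cnt_def length_filter_conv_card)

lemma cnt_map: "cnt (map f a) k = length (filter (\<lambda>x. f x \<le> k) a)"
  by (simp add: cnt_def filter_map o_def)

lemma cnt_append [simp]: "cnt (a @ b) k = cnt a k + cnt b k"
  by (simp add: cnt_def)

lemma cnt_cong_mset: "mset a = mset b \<Longrightarrow> cnt a = cnt b"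
  unfolding cnt_def by (metis mset_filter size_mset)

lemma cnt_le_length: "cnt a k \<le> length a"
  by (simp add: cnt_def)

lemma cnt_mono: "x \<le> y \<Longrightarrow> cnt a x \<le> cnt a y"
  unfolding cnt_def by (induction a) auto

lemma cnt_less_cnt: "x \<in> set a \<Longrightarrow> y < x \<Longrightarrow> cnt a y < cnt a x"
proof (induction a)
  case (Cons z a)
  have "cnt a y \<le> cnt a x" using Cons.prems by (simp add: cnt_mono)
  with Cons show ?case by (auto simp: cnt_def)
qed simp

lemma cnt_0: "0 \<notin> set a \<Longrightarrow> cnt a 0 = 0"
  unfolding cnt_def by (induction a) auto

lemma parking_cnt: "parking a \<longleftrightarrow> 0 \<notin> set a \<and> (\<forall>i\<le>length a. i \<le> cnt a i)"
  by (simp add: parking_iff cnt_conv_card)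

lemma parking_le_length: "parking a \<Longrightarrow> x \<in> set a \<Longrightarrow> x \<le> length a"
  by (auto simp: parking_def)

lemma parking_cnt_length: "parking a \<Longrightarrow> cnt a (length a) = length a"
  by (simp add: parking_cnt cnt_le_length le_antisym)

text \<open>The letters of \<open>v\<close> from \<open>y + 1\<close> to \<open>k\<close> are among
  those of \<open>w\<close>; the additive form avoids truncated subtraction.\<close>

lemma cnt_sub_mset:
  assumes "mset v \<subseteq># mset w" "y \<le> k"
  shows "cnt v k + cnt w y \<le> cnt w k + cnt v y"
proof -
  obtain r where "mset w = mset v + mset r"
    using assms(1) by (metis ex_mset subset_mset.le_iff_add)
  then have "cnt w = cnt (v @ r)" by (intro cnt_cong_mset) simp
  then show ?thesis using cnt_mono[OF assms(2), of r] by simp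
qed

text \<open>\<open>new_pos a x\<close> is the image under parkization of the position \<open>x\<close>: it follows \<open>x\<close>, except that
  it may not exceed the number of letters seen so far.\<close>

primrec new_pos :: "nat list \<Rightarrow> nat \<Rightarrow> nat" where
  "new_pos a 0 = 0"
| "new_pos a (Suc x) = min (Suc (new_pos a x)) (cnt a (Suc x))"

text \<open>At a letter this equals \<open>new_pos a x\<close>. Stepping up from the preceding
  position makes every label positive and yields strict monotonicity from the weak monotonicity of
  \<open>new_pos\<close>.\<close>

definition relabel :: "nat list \<Rightarrow> nat \<Rightarrow> nat" where
  "relabel a x = Suc (new_pos a (x - 1))"

lemma relabel_cong:
  assumes "cnt a = cnt b"
  shows "relabel a = relabel b"
proof -
  have "new_pos a x = new_pos b x" for x
    by (induction x) (simp_all add: assms)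
  then show ?thesis by (simp add: relabel_def fun_eq_iff)
qed

lemma relabel_cong_mset: "mset a = mset b \<Longrightarrow> relabel a = relabel b"
  by (intro relabel_cong cnt_cong_mset)

lemma new_pos_le_cnt: "new_pos a x \<le> cnt a x"
  by (cases x) auto

lemma new_pos_mono: "x \<le> y \<Longrightarrow> new_pos a x \<le> new_pos a y"
proof (rule lift_Suc_mono_le[of "new_pos a"])
  fix n show "new_pos a n \<le> new_pos a (Suc n)"
    using new_pos_le_cnt[of a n] cnt_mono[of n "Suc n" a] by simp
qed auto

text \<open>Unrolled, the recursion computes the minimum of \<open>x - y + cnt a y\<close> over all
  \<open>y \<le> x\<close>, climbing freely after the last position where the cap was attained. This
  is the lower bound; \<open>y = 0\<close> matches the initial value because no letter is
  \<open>0\<close>.\<close>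

lemma new_pos_greatest:
  assumes "0 \<notin> set a" "\<And>y. y \<le> x \<Longrightarrow> n \<le> x - y + cnt a y"
  shows "n \<le> new_pos a x"
  using assms(2)
proof (induction x arbitrary: n)
  case 0
  then show ?case using assms(1) by (simp add: cnt_0)
next
  case (Suc x)
  have "n - 1 \<le> x - y + cnt a y" if "y \<le> x" for y
    using Suc.prems[of y] that by (simp add: Suc_diff_le)
  then have "n - 1 \<le> new_pos a x" by (rule Suc.IH)
  with Suc.prems[of "Suc x"] show ?case by simp
qed

text \<open>A breakpoint of a parking function remains a breakpoint of every parkized subword. The relevant
  bound is that at most \<open>k - y\<close> letters of \<open>w\<close>, hence of \<open>v\<close>, lie in the interval from \<open>y + 1\<close> to
  \<open>k\<close>.\<close>

lemma new_pos_break: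
  assumes "0 \<notin> set v" "mset v \<subseteq># mset w" "\<And>y. y \<le> k \<Longrightarrow> y \<le> cnt w y" "cnt w k = k"
  shows "new_pos v k = cnt v k"
proof (rule antisym[OF new_pos_le_cnt], rule new_pos_greatest[OF assms(1)])
  fix y assume "y \<le> k"
  then show "cnt v k \<le> k - y + cnt v y"
    using cnt_sub_mset[OF assms(2), of y k] assms(3)[of y] assms(4) by simp
qed

text \<open>The count increases at a letter, so the cap in \<open>new_pos\<close> leaves room for
  the step there.\<close>

lemma new_pos_letter:
  assumes "x \<in> set a" "0 \<notin> set a"
  shows "new_pos a x = relabel a x"
proof -
  have "x \<noteq> 0" using assms by metis
  then obtain z where x: "x = Suc z" using not0_implies_Suc by blast
  have "cnt a z < cnt a x" using assms(1) by (rule cnt_less_cnt) (simp add: x)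
  then show ?thesis using new_pos_le_cnt[of a z] by (simp add: x relabel_def)
qed

lemma relabel_less:
  assumes "x < y" "x \<in> set a" "0 \<notin> set a"
  shows "relabel a x < relabel a y"
proof -
  have "relabel a x = new_pos a x" using assms by (simp add: new_pos_letter)
  also have "\<dots> \<le> new_pos a (y - 1)" using assms by (intro new_pos_mono) simp
  finally show ?thesis by (simp add: relabel_def)
qed

lemma relabel_less_iff:
  assumes "x \<in> set a" "y \<in> set a" "0 \<notin> set a"
  shows "relabel a x < relabel a y \<longleftrightarrow> x < y"
  using relabel_less[of x y a] relabel_less[of y x a] assms
  by (cases x y rule: linorder_cases) auto

lemma inj_on_relabel: "0 \<notin> set a \<Longrightarrow> inj_on (relabel a) (set a)"
  by (rule inj_onI) (metis relabel_less_iff less_irrefl linorder_neqE_nat)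

text \<open>The parking condition says that the cap never binds up to the length of the
  word.\<close>

lemma relabel_parking:
  assumes "parking a" "x \<in> set a"
  shows "relabel a x = x"
proof -
  have "new_pos a y = y" if "y \<le> length a" for y
    using that
  proof (induction y)
    case (Suc y)
    have "Suc y \<le> cnt a (Suc y)" using assms(1) Suc.prems unfolding parking_cnt by blast
    with Suc show ?case by simp
  qed simp
  moreover have "x \<noteq> 0" "x \<le> length a" using assms by (auto simp: parking_def)
  ultimately show ?thesis by (simp add: relabel_def)
qed

text \<open>The count is at least \<open>d - 1\<close> at \<open>d - 1\<close> and below
  \<open>d\<close> at the first defect \<open>d\<close>, so it is \<open>d - 1\<close> at both: the
  defect is an unoccupied position right after a breakpoint.\<close>

lemma park_defect:
  assumes "0 \<notin> set w"
  shows "0 < park_defect w" "\<And>y. y < park_defect w \<Longrightarrow> y \<le> cnt w y"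
    "cnt w (park_defect w - 1) = park_defect w - 1" "park_defect w \<notin> set w"
proof -
  let ?d = "park_defect w"
  have less: "cnt w ?d < ?d" using park_defect_less[of w] by (simp add: cnt_conv_card)
  then show pos: "0 < ?d" by simp
  show le: "y \<le> cnt w y" if "y < ?d" for y
    using not_less_Least[of y "\<lambda>i. card {j. j < length w \<and> w ! j \<le> i} < i"] that
    by (simp add: park_defect_def cnt_conv_card)
  have "?d - 1 \<le> cnt w (?d - 1)" using pos by (intro le) simp
  moreover have "cnt w (?d - 1) \<le> cnt w ?d" by (rule cnt_mono) simp
  ultimately show "cnt w (?d - 1) = ?d - 1" using less by simp
  show "?d \<notin> set w"
  proof
    assume "?d \<in> set w"
    then have "cnt w (?d - 1) < cnt w ?d" using pos by (intro cnt_less_cnt) simp_all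
    then show False using less \<open>?d - 1 \<le> cnt w (?d - 1)\<close> by simp
  qed
qed

text \<open>\<open>new_pos v\<close> is constant from \<open>d - 1\<close> to \<open>d\<close>:
  \<open>d - 1\<close> is a breakpoint of \<open>w\<close>, hence saturated for every subword, and
  \<open>d\<close> carries no letter. Deleting \<open>d\<close> therefore leaves all labels
  unchanged. A sub-multiset \<open>v\<close> is allowed because the recursion removes defects of the
  whole word while the labels of a piece are compared.\<close>

lemma relabel_park_step:
  fixes w :: "nat list"
  defines "dec \<equiv> \<lambda>x. if x > park_defect w then x - 1 else x"
  assumes w: "0 \<notin> set w" and v: "mset v \<subseteq># mset w" and x: "x \<in> set v"
  shows "relabel (map dec v) (dec x) = relabel v x"
proof -
  define d where "d = park_defect w"
  note d = park_defect[OF w, folded d_def]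
  have sub: "set v \<subseteq> set w" using v by (metis set_mset_mono set_mset_mset)
  have dv: "d \<notin> set v" and v0: "0 \<notin> set v" using sub w d by auto
  have dec: "dec = (\<lambda>x. if x > d then x - 1 else x)" by (simp add: dec_def d_def)
  have cnt_less: "cnt (map dec v) y = cnt v y" if "y < d" for y
    unfolding cnt_def using that by (induction v) (auto simp: dec)
  \<comment> \<open>At \<open>y = d - 1\<close> this depends on \<open>d\<close> being unoccupied: a
    letter \<open>d\<close> would not be decremented, yet it would count on the right.\<close>
  have cnt_ge: "cnt (map dec v) y = cnt v (Suc y)" if "d - 1 \<le> y" for y
    using that dv unfolding cnt_def by (induction v) (auto simp: dec)
  have pos_less: "new_pos (map dec v) y = new_pos v y" if "y < d" for y
    using that by (induction y) (simp_all add: cnt_less)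
  have brk: "new_pos v (d - 1) = cnt v (d - 1)"
    using d by (intro new_pos_break[OF v0 v]) auto
  have "cnt v (d - 1) = cnt v d"
    using cnt_less[of "d - 1"] cnt_ge[of "d - 1"] d(1) by simp
  \<comment> \<open>The cap at \<open>d\<close> equals the value already reached at
    \<open>d - 1\<close>, so the step is suppressed.\<close>
  then have pos_d: "new_pos v d = new_pos v (d - 1)"
    using brk d(1) by (cases d) auto
  have "new_pos (map dec v) y = new_pos v (Suc y)" if "d - 1 \<le> y" for y
    using that
  proof (induction y rule: nat_induct_at_least)
    case base
    then show ?case using d(1) pos_d by (simp add: pos_less)
  next
    case (Suc y)
    then show ?case by (simp add: cnt_ge)
  qed
  \<comment> \<open>A letter \<open>x > d\<close> becomes \<open>x - 1\<close>, whose label is read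
    from the position \<open>x - 2\<close>; below \<open>d\<close> no position has moved.\<close>
  from this[of "x - 2"] show ?thesis
    using dv x pos_less[of "x - 1"] d(1)
    by (cases "d < x") (auto simp: relabel_def dec numeral_2_eq_2 Suc_diff_Suc)
qed

lemma parkization_eq_relabel:
  assumes "0 \<notin> set w"
  shows "parkization w = map (relabel w) w"
  using assms
proof (induction w rule: parkization.induct)
  case (1 w)
  show ?case
  proof (cases "park_defect w = Suc (length w)")
    case True
    then have "parkization w = w" by (simp add: parkization.simps)
    moreover from this have "parking w" using parking_parkization[OF "1.prems"] by simp
    ultimately show ?thesis by (simp add: map_idI relabel_parking)
  next
    case False
    have "0 < park_defect w" using park_defect(1)[OF "1.prems"] .
    then have "0 \<notin> set (park_step w)"
      using "1.prems" by (auto simp: park_step_def split: if_splits)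
    then have "parkization w = map (relabel (park_step w)) (park_step w)"
      using "1.IH"[OF False] False by (simp add: parkization.simps[of w])
    then show ?thesis
      using relabel_park_step[OF "1.prems" subset_mset.order_refl]
      by (simp add: park_step_def)
  qed
qed

text \<open>Parkizing the whole word first does not affect the parkization of a piece. Each step of
  the recursion for \<open>w\<close> is invisible to the labels of \<open>v\<close>; both words
  change along the induction, so \<open>v\<close> is generalized. This is what iterated coproducts
  rest on.\<close>

lemma relabel_relabel:
  assumes "0 \<notin> set w" "mset v \<subseteq># mset w" "x \<in> set v"
  shows "relabel (map (relabel w) v) (relabel w x) = relabel v x"
  using assms
proof (induction w arbitrary: v x rule: parkization.induct)
  case (1 w)
  have sub: "set v \<subseteq> set w" using "1.prems"(2) by (metis set_mset_mono set_mset_mset)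
  show ?case
  proof (cases "park_defect w = Suc (length w)")
    case True
    then have "parkization w = w" by (simp add: parkization.simps)
    then have "parking w" using parking_parkization[OF "1.prems"(1)] by simp
    then have "relabel w y = y" if "y \<in> set v" for y using that sub by (auto simp: relabel_parking)
    then show ?thesis using "1.prems"(3) by (simp add: map_idI)
  next
    case False
    let ?dec = "\<lambda>x. if x > park_defect w then x - 1 else x"
    have "0 < park_defect w" using park_defect(1)[OF "1.prems"(1)] .
    then have "0 \<notin> set (park_step w)"
      using "1.prems"(1) by (auto simp: park_step_def split: if_splits)
    moreover have "mset (map ?dec v) \<subseteq># mset (park_step w)"
      unfolding park_step_def mset_map using "1.prems"(2) by (rule image_mset_subseteq_mono)
    moreover have "?dec x \<in> set (map ?dec v)" using "1.prems"(3) by auto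
    ultimately have IH: "relabel (map (relabel (park_step w)) (map ?dec v))
        (relabel (park_step w) (?dec x)) = relabel (map ?dec v) (?dec x)"
      by (rule "1.IH"[OF False])
    have eq: "relabel (park_step w) (?dec y) = relabel w y" if "y \<in> set v" for y
      unfolding park_step_def
      using relabel_park_step[OF "1.prems"(1) subset_mset.order_refl, of y] that sub by auto
    have map_eq: "map (relabel (park_step w)) (map ?dec v) = map (relabel w) v"
      using eq by simp
    show ?thesis
      using IH unfolding map_eq eq[OF "1.prems"(3)] relabel_park_step[OF "1.prems"] .
  qed
qed

text \<open>At a breakpoint, \<open>new_pos v k\<close> is exactly the number of letters of
  \<open>v\<close> up to \<open>k\<close>, so these letters use the labels up to that number and
  larger letters come after it. A cut of \<open>w\<close> thus turns into a cut of the parkized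
  \<open>v\<close>.\<close>

lemma relabel_le_break_iff:
  assumes "parking w" "k \<le> length w" "cnt w k = k" "mset v \<subseteq># mset w" "x \<in> set v"
  shows "relabel v x \<le> cnt v k \<longleftrightarrow> x \<le> k"
proof -
  have "set v \<subseteq> set w" using assms(4) by (metis set_mset_mono set_mset_mset)
  then have v0: "0 \<notin> set v" using assms(1) by (auto simp: parking_cnt)
  have brk: "new_pos v k = cnt v k"
    using assms by (intro new_pos_break[OF v0 assms(4)]) (auto simp: parking_cnt)
  show ?thesis
  proof (cases "x \<le> k")
    case True
    then have "new_pos v x \<le> cnt v k" using new_pos_mono[of x k v] brk by simp
    then show ?thesis using True new_pos_letter[OF assms(5) v0] by simp
  next
    case False
    then have "new_pos v k \<le> new_pos v (x - 1)" by (intro new_pos_mono) simp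
    then show ?thesis using False brk by (simp add: relabel_def)
  qed
qed

lemma relabel_append_low:
  assumes "\<forall>x\<in>set b. k < x" "x \<le> k"
  shows "relabel (a @ b) x = relabel a x"
proof -
  have "cnt b y = 0" if "y \<le> k" for y
    using that assms(1) by (fastforce simp: cnt_def filter_empty_conv)
  then have "new_pos (a @ b) y = new_pos a y" if "y \<le> k" for y
    using that by (induction y) auto
  then show ?thesis using assms(2) by (simp add: relabel_def)
qed

text \<open>Once position \<open>k\<close> is saturated, the recursion restarts there from the value
  \<open>length a\<close>, and the letters of \<open>b\<close> are labelled as if they stood
  alone.\<close>

lemma relabel_append_high:
  assumes "\<forall>x\<in>set a. x \<le> k" "0 \<notin> set b" "new_pos (a @ map (\<lambda>x. x + k) b) k = length a" "0 < x"
  shows "relabel (a @ map (\<lambda>x. x + k) b) (x + k) = length a + relabel b x"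
proof -
  have cnt: "cnt (a @ map (\<lambda>x. x + k) b) (k + y) = length a + cnt b y" for y
  proof -
    have "filter (\<lambda>x. x \<le> k + y) a = a" using assms(1) by (intro filter_True) auto
    moreover have "cnt (map (\<lambda>x. x + k) b) (k + y) = cnt b y"
      by (induction b) (auto simp: cnt_def)
    ultimately show ?thesis by (simp add: cnt_def)
  qed
  have "new_pos (a @ map (\<lambda>x. x + k) b) (k + y) = length a + new_pos b y" for y
  proof (induction y)
    case 0
    then show ?case using assms(3) by simp
  next
    case (Suc y)
    then show ?case using cnt[of "Suc y"] by simp
  qed
  from this[of "x - 1"] show ?thesis using assms(4) by (simp add: relabel_def add.commute)
qed

section \<open>Colored words\<close>

abbreviation recolor :: "(nat \<Rightarrow> nat) \<Rightarrow> colored_word \<Rightarrow> colored_word" where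
  "recolor f \<equiv> map (apfst f)"

abbreviation letters :: "colored_word \<Rightarrow> nat list" where
  "letters \<equiv> map fst"

lemma letters_recolor [simp]: "letters (recolor f w) = map f (letters w)"
  by simp

lemma colored_park_eq:
  assumes "0 \<notin> set (letters w)"
  shows "colored_park w = recolor (relabel (letters w)) w"
proof -
  have "zip (map f (letters w)) (map snd w) = recolor f w" for f
    by (induction w) auto
  then show ?thesis
    by (simp only: colored_park_def parkization_eq_relabel[OF assms])
qed

lemma length_colored_park [simp]: "length (colored_park w) = length w"
  by (simp add: colored_park_def)

lemma colored_park_parking:
  assumes "parking (letters w)"
  shows "colored_park w = w"
proof -
  have "relabel (letters w) (fst p) = fst p" if "p \<in> set w" for p
    using that by (intro relabel_parking[OF assms]) auto
  then show ?thesis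
    using assms by (auto simp: colored_park_eq parking_cnt apfst_def map_prod_def intro!: map_idI)
qed

lemma colored_park_recolor:
  assumes "0 \<notin> set (letters w)" "mset v \<subseteq># mset w"
  shows "colored_park (recolor (relabel (letters w)) v) = colored_park v"
proof -
  let ?f = "relabel (letters w)"
  have "set v \<subseteq> set w" using assms(2) by (metis set_mset_mono set_mset_mset)
  then have v0: "0 \<notin> set (letters v)" using assms(1) by auto
  have f0: "0 \<notin> set (letters (recolor ?f v))" by (auto simp: relabel_def)
  have sub: "mset (letters v) \<subseteq># mset (letters w)"
    unfolding mset_map using assms(2) by (rule image_mset_subseteq_mono)
  have "relabel (map ?f (letters v)) (?f (fst p)) = relabel (letters v) (fst p)" if "p \<in> set v" for p
    using that by (intro relabel_relabel[OF assms(1) sub]) auto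
  then show ?thesis
    unfolding colored_park_eq[OF v0] colored_park_eq[OF f0] letters_recolor
    by (simp add: apfst_def map_prod_def case_prod_beta)
qed

lemma sub_mset_take: "mset (take i w) \<subseteq># mset w" and sub_mset_drop: "mset (drop i w) \<subseteq># mset w"
  by (metis append_take_drop_id mset_append mset_subset_eq_add_left mset_subset_eq_add_right)+

lemma colored_park_take: "0 \<notin> set (letters w) \<Longrightarrow>
    colored_park (take i (colored_park w)) = colored_park (take i w)"
  and colored_park_drop: "0 \<notin> set (letters w) \<Longrightarrow>
    colored_park (drop i (colored_park w)) = colored_park (drop i w)"
  by (simp_all add: colored_park_eq[of w] take_map drop_map colored_park_recolor
      sub_mset_take sub_mset_drop)

lemma colored_park_permute:
  assumes "0 \<notin> set (letters w)" "\<sigma> permutes {..<length w}"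
  shows "colored_park (permute_list \<sigma> w) = permute_list \<sigma> (colored_park w)"
proof -
  have eq: "mset (permute_list \<sigma> w) = mset w" using assms(2) by simp
  have "set (permute_list \<sigma> w) = set w" using assms(2) by simp
  then have "0 \<notin> set (letters (permute_list \<sigma> w))" using assms(1) by simp
  moreover have "relabel (letters (permute_list \<sigma> w)) = relabel (letters w)"
    by (rule relabel_cong_mset) (simp only: mset_map eq)
  ultimately show ?thesis
    using assms by (simp add: colored_park_eq permute_list_map)
qed

section \<open>Cutting a word at a breakpoint\<close>

definition low :: "nat \<Rightarrow> colored_word \<Rightarrow> colored_word" where
  "low k w = filter (\<lambda>p. fst p \<le> k) w"

definition high :: "nat \<Rightarrow> colored_word \<Rightarrow> colored_word" where
  "high k w = map (\<lambda>(x, c). (x - k, c)) (filter (\<lambda>p. k < fst p) w)"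

abbreviation breaks :: "colored_word \<Rightarrow> nat set" where
  "breaks w \<equiv> {k. k \<le> length w \<and> cnt (letters w) k = k}"

lemma length_low: "length (low k w) = cnt (letters w) k"
  by (simp add: low_def cnt_def filter_map o_def)

lemma length_high: "length (high k w) = length w - cnt (letters w) k"
proof -
  have "length (low k w) + length (high k w) = length w"
    unfolding low_def high_def length_map by (induction w) auto
  then show ?thesis by (simp add: length_low)
qed

lemma mem_high: "p \<in> set w \<Longrightarrow> k < fst p \<Longrightarrow> (fst p - k, snd p) \<in> set (high k w)"
  unfolding high_def by (cases p) force

lemma cnt_low: "cnt (letters (low k w)) j = cnt (letters w) (min j k)"
  unfolding low_def cnt_def by (induction w) auto

lemma cnt_high: "cnt (letters w) (k + j) = cnt (letters w) k + cnt (letters (high k w)) j"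
  unfolding high_def cnt_def by (induction w) auto

lemma low_low: "j \<le> k \<Longrightarrow> low j (low k w) = low j w"
  unfolding low_def by (induction w) auto

lemma high_low: "j \<le> k \<Longrightarrow> high j (low k w) = low (k - j) (high j w)"
  unfolding low_def high_def by (induction w) auto

lemma high_high: "high i (high j w) = high (i + j) w"
  unfolding high_def by (induction w) auto

lemma parking_low:
  assumes "parking (letters w)" "k \<in> breaks w"
  shows "parking (letters (low k w))"
proof -
  have "0 \<notin> set (letters (low k w))" using assms(1) by (auto simp: parking_cnt low_def)
  moreover have "i \<le> cnt (letters (low k w)) i" if "i \<le> length (low k w)" for i
    using that assms by (simp add: cnt_low length_low parking_cnt)
  ultimately show ?thesis by (simp add: parking_cnt)
qed

lemma parking_high:
  assumes "parking (letters w)" "k \<in> breaks w"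
  shows "parking (letters (high k w))"
proof -
  have "0 \<notin> set (letters (high k w))" by (auto simp: high_def)
  moreover have "i \<le> cnt (letters (high k w)) i" if "i \<le> length (high k w)" for i
  proof -
    have "k + i \<le> length w" using that assms(2) by (auto simp: length_high)
    then have "k + i \<le> cnt (letters w) (k + i)" using assms(1) by (auto simp: parking_cnt)
    then show ?thesis using assms(2) by (simp add: cnt_high)
  qed
  ultimately show ?thesis by (simp add: parking_cnt)
qed

section \<open>Shuffles and their parkization\<close>

lemma letters_shift: "letters (shift k w) = map (\<lambda>x. x + k) (letters w)"
  by (auto simp: shift_def)

lemma length_shift [simp]: "length (shift k w) = length w"
  by (simp add: shift_def)

lemma take_shift: "take i (shift k w) = shift k (take i w)"
  and drop_shift: "drop i (shift k w) = shift k (drop i w)"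
  by (simp_all add: shift_def take_map drop_map)

lemma shift_Nil [simp]: "shift k [] = []"
  by (simp add: shift_def)

text \<open>If a predicate tells the letters of the two words apart, filtering recovers both words
  from a shuffle. For shifted shuffles the predicate is "at most \<open>k\<close>", which makes the
  factors of a given word readable from the word.\<close>

lemma mem_shuffles_iff:
  assumes "\<forall>p\<in>set v. P p" "\<forall>p\<in>set w. \<not> P p"
  shows "z \<in> shuffles v w \<longleftrightarrow> filter P z = v \<and> filter (\<lambda>p. \<not> P p) z = w"
proof
  assume z: "z \<in> shuffles v w"
  have "filter P z \<in> shuffles (filter P v) (filter P w)"
    "filter (\<lambda>p. \<not> P p) z \<in> shuffles (filter (\<lambda>p. \<not> P p) v) (filter (\<lambda>p. \<not> P p) w)"
    using z by (auto simp flip: filter_shuffles)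
  moreover have "filter P v = v" "filter P w = []" "filter (\<lambda>p. \<not> P p) v = []"
    "filter (\<lambda>p. \<not> P p) w = w"
    using assms by (auto simp: filter_empty_conv)
  ultimately show "filter P z = v \<and> filter (\<lambda>p. \<not> P p) z = w" by simp
next
  assume "filter P z = v \<and> filter (\<lambda>p. \<not> P p) z = w"
  then show "z \<in> shuffles v w" using partition_in_shuffles[of z P] by simp
qed

lemma shifted_shuffle_iff:
  assumes "parking (letters v)" "0 \<notin> set (letters w)"
  shows "z \<in> shifted_shuffle v w \<longleftrightarrow>
    length v \<in> breaks z \<and> low (length v) z = v \<and> high (length v) z = w"
proof -
  let ?k = "length v"
  have v: "\<forall>p\<in>set v. fst p \<le> ?k"
    using parking_le_length[OF assms(1)] by simp
  have w: "\<forall>p\<in>set (shift ?k w). \<not> fst p \<le> ?k"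
    using assms(2) by (force simp: shift_def)
  have shift: "filter (\<lambda>p. \<not> fst p \<le> ?k) z = shift ?k w \<longleftrightarrow> high ?k z = w"
  proof
    assume "filter (\<lambda>p. \<not> fst p \<le> ?k) z = shift ?k w"
    then have "high ?k z = map (\<lambda>(x, c). (x - ?k, c)) (shift ?k w)"
      by (simp add: high_def not_le)
    then show "high ?k z = w" by (auto simp: shift_def intro!: map_idI)
  next
    assume "high ?k z = w"
    moreover have "shift ?k (high ?k z) = filter (\<lambda>p. \<not> fst p \<le> ?k) z"
      unfolding high_def shift_def by (induction z) auto
    ultimately show "filter (\<lambda>p. \<not> fst p \<le> ?k) z = shift ?k w" by simp
  qed
  \<comment> \<open>The lower part having length \<open>?k\<close> already says that
    \<open>?k\<close> is a breakpoint.\<close>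
  have "low ?k z = v \<Longrightarrow> ?k \<in> breaks z"
    using length_low[of ?k z] cnt_le_length[of "letters z" ?k] by simp
  then show ?thesis
    unfolding shifted_shuffle_def mem_shuffles_iff[OF v w] shift by (auto simp: low_def)
qed

lemma append_mem_shifted_shuffle:
  assumes "parking (letters v)" "0 \<notin> set (letters w)"
  shows "v @ shift (length v) w \<in> shifted_shuffle v w"
proof -
  have v: "\<forall>p\<in>set v. fst p \<le> length v"
    using parking_le_length[OF assms(1)] by simp
  have w: "\<forall>p\<in>set (shift (length v) w). \<not> fst p \<le> length v"
    using assms(2) by (force simp: shift_def)
  show ?thesis
    unfolding shifted_shuffle_def mem_shuffles_iff[OF v w]
    using v w by (auto simp: filter_empty_conv intro!: filter_True)
qed

lemma map_shuffles: "shuffles (map f v) (map f w) = map f ` shuffles v w"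
  by (induction v w rule: shuffles.induct) (simp_all add: image_Un image_image)

text \<open>The letters of \<open>v'\<close> and of \<open>w'[k]\<close> are separated by the breakpoint \<open>k\<close> of \<open>v \<bullet> w\<close>, so
  parkization relabels the two parts independently of each other.\<close>

lemma colored_park_shuffles:
  assumes v: "parking (letters v)" and w: "parking (letters w)"
    and v': "mset v' \<subseteq># mset v" and w': "mset w' \<subseteq># mset w"
  shows "bij_betw colored_park (shuffles v' (shift (length v) w'))
    (shifted_shuffle (colored_park v') (colored_park w'))"
proof -
  let ?k = "length v" and ?u = "v' @ shift (length v) w'" and ?U = "v @ shift (length v) w"
  let ?f = "relabel (letters ?u)"
  have subs: "set v' \<subseteq> set v" "set w' \<subseteq> set w"
    using v' w' by (metis set_mset_mono set_mset_mset)+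
  have v0: "0 \<notin> set (letters v)" and w0: "0 \<notin> set (letters w)"
    using v w by (simp_all add: parking_cnt)
  then have v'0: "0 \<notin> set (letters v')" and w'0: "0 \<notin> set (letters w')" using subs by auto
  have u0: "0 \<notin> set (letters ?u)"
    using v'0 w'0 by (force simp: shift_def)
  have v_le: "\<forall>x\<in>set (letters v). x \<le> ?k" using parking_le_length[OF v] by simp
  then have v'_le: "\<forall>x\<in>set (letters v'). x \<le> ?k" using subs by auto
  have high: "\<forall>x\<in>set (letters (shift ?k w')). ?k < x" "\<forall>x\<in>set (letters (shift ?k w)). ?k < x"
    using w'0 w0 by (force simp: letters_shift)+
  \<comment> \<open>\<open>?U\<close> is the ambient parking function: it has the breakpoint
    \<open>?k\<close> and contains the letters of \<open>?u\<close>, so \<open>new_pos_break\<close>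
    applies to \<open>?u\<close>, which need not be a parking function.\<close>
  have parkU: "parking (letters ?U)"
    by (rule parking_shifted_shuffle[OF v w append_mem_shifted_shuffle[OF v w0]])
  have brkU: "cnt (letters ?U) ?k = ?k"
  proof -
    have "cnt (letters v) ?k = ?k" using parking_cnt_length[OF v] by simp
    moreover have "cnt (letters (shift ?k w)) ?k = 0"
      using high(2) by (fastforce simp: cnt_def filter_empty_conv)
    ultimately show ?thesis by simp
  qed
  have subU: "mset (letters ?u) \<subseteq># mset (letters ?U)"
  proof -
    have "mset (shift ?k w') \<subseteq># mset (shift ?k w)"
      unfolding shift_def mset_map using w' by (rule image_mset_subseteq_mono)
    then have "mset ?u \<subseteq># mset ?U" using v' by (simp add: subset_mset.add_mono)
    then show ?thesis unfolding mset_map by (rule image_mset_subseteq_mono)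
  qed
  have "new_pos (letters ?u) ?k = cnt (letters ?u) ?k"
    using parkU brkU by (intro new_pos_break[OF u0 subU]) (simp_all add: parking_cnt)
  also have "\<dots> = length v'"
  proof -
    have "cnt (letters (shift ?k w')) ?k = 0"
      using high(1) by (fastforce simp: cnt_def filter_empty_conv)
    moreover have "cnt (letters v') ?k = length v'"
      using v'_le by (simp add: cnt_def)
    ultimately show ?thesis by simp
  qed
  finally have brku: "new_pos (letters ?u) ?k = length v'" .
  have fv: "recolor ?f v' = colored_park v'"
    unfolding colored_park_eq[OF v'0]
    using relabel_append_low[OF high(1), of _ "letters v'"] v'_le by auto
  have shifted: "?f (x + ?k) = length v' + relabel (letters w') x" if "x \<in> set (letters w')" for x
  proof -
    have "0 < x" using that w'0 by (metis gr0I)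
    then show ?thesis
      using relabel_append_high[of "letters v'" ?k "letters w'" x] v'_le w'0 brku
      by (simp add: letters_shift)
  qed
  have fw: "recolor ?f (shift ?k w') = shift (length v') (colored_park w')"
  proof -
    define f where "f = ?f"
    have "f (x + ?k) = length v' + relabel (letters w') x" if "x \<in> set (letters w')" for x
      unfolding f_def using that by (rule shifted)
    then have "recolor f (shift ?k w') = shift (length v') (colored_park w')"
      unfolding colored_park_eq[OF w'0] by (force simp: shift_def add.commute)
    then show ?thesis by (simp only: f_def)
  qed
  \<comment> \<open>All shuffles have the same multiset of letters, so the single function
    \<open>?f\<close> parkizes every one of them.\<close>
  have park: "colored_park z = recolor ?f z" if "z \<in> shuffles v' (shift ?k w')" for z
  proof -
    have eq: "mset z = mset ?u" using that by (simp add: mset_shuffles)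
    then have "set (letters z) = set (letters ?u)" by (metis mset_map set_mset_mset)
    then have "0 \<notin> set (letters z)" using u0 by simp
    moreover have "relabel (letters z) = ?f"
      by (rule relabel_cong_mset) (simp only: mset_map eq)
    ultimately show ?thesis by (simp add: colored_park_eq)
  qed
  have "inj_on (recolor ?f) (shuffles v' (shift ?k w'))"
  proof (rule inj_on_subset)
    have "inj_on (apfst ?f) (set ?u :: (nat \<times> bool) set)"
    proof (rule inj_onI)
      fix p q :: "nat \<times> bool"
      assume pq: "p \<in> set ?u" "q \<in> set ?u" "apfst ?f p = apfst ?f q"
      then have "fst p \<in> set (letters ?u)" "fst q \<in> set (letters ?u)" by (metis image_eqI list.set_map)+
      moreover have "?f (fst p) = ?f (fst q)" "snd p = snd q"
        using pq(3) by (metis fst_apfst, metis snd_apfst)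
      ultimately show "p = q" using inj_onD[OF inj_on_relabel[OF u0]] by (blast intro: prod_eqI)
    qed
    then show "inj_on (recolor ?f) (lists (set ?u))" by (simp add: inj_on_map_lists)
    show "shuffles v' (shift ?k w') \<subseteq> lists (set ?u)"
      using set_shuffles[of _ v' "shift ?k w'"] by auto
  qed
  then have "bij_betw (recolor ?f) (shuffles v' (shift ?k w'))
      (shuffles (recolor ?f v') (recolor ?f (shift ?k w')))"
    unfolding map_shuffles by (rule inj_on_imp_bij_betw)
  then show ?thesis
    unfolding fv fw shifted_shuffle_def length_colored_park by (subst bij_betw_cong[OF park])
qed

section \<open>Signed parking functions\<close>

text \<open>For \<open>fst p = fst q\<close> no such \<open>b\<close> exists, so equal letters are
  forced to have equal colors.\<close>

definition signed :: "colored_word \<Rightarrow> bool" where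
  "signed w \<longleftrightarrow> parking (letters w) \<and> (\<forall>p\<in>set w. \<forall>q\<in>set w. fst p \<le> fst q \<longrightarrow> snd p \<noteq> snd q \<longrightarrow>
     (\<exists>b. fst p \<le> b \<and> b < fst q \<and> cnt (letters w) b = b))"

lemma signedD:
  assumes "signed w" "p \<in> set w" "q \<in> set w" "fst p \<le> fst q" "snd p \<noteq> snd q"
  shows "\<exists>b. fst p \<le> b \<and> b < fst q \<and> cnt (letters w) b = b"
  using assms unfolding signed_def by blast

lemma parking_cong_mset:
  assumes "mset v = mset w"
  shows "parking v \<longleftrightarrow> parking w"
  using assms cnt_cong_mset[OF assms] by (metis parking_cnt mset_eq_setD size_mset)

lemma mset_letters_cong: "mset v = mset w \<Longrightarrow> mset (letters v) = mset (letters w)"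
  by (simp only: mset_map)

lemma signed_cong_mset:
  assumes "mset v = mset w"
  shows "signed v \<longleftrightarrow> signed w"
  using mset_letters_cong[OF assms, THEN parking_cong_mset]
    mset_letters_cong[OF assms, THEN cnt_cong_mset] mset_eq_setD[OF assms]
  by (simp add: signed_def)

text \<open>Parkization preserves the order of the letters, and a breakpoint \<open>b\<close> of
  \<open>w\<close> separating two of them is carried to the number \<open>cnt (letters v) b\<close>,
  which separates their labels.\<close>

lemma signed_colored_park:
  assumes "signed w" "mset v \<subseteq># mset w"
  shows "signed (colored_park v)"
proof -
  let ?f = "relabel (letters v)"
  have w: "parking (letters w)" using assms(1) by (simp add: signed_def)
  have sub: "set v \<subseteq> set w" using assms(2) by (metis set_mset_mono set_mset_mset)
  then have v0: "0 \<notin> set (letters v)" using w by (auto simp: parking_cnt)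
  have subl: "mset (letters v) \<subseteq># mset (letters w)"
    unfolding mset_map using assms(2) by (rule image_mset_subseteq_mono)
  have "\<exists>b. fst p \<le> b \<and> b < fst q \<and> cnt (letters (colored_park v)) b = b"
    if pq: "p \<in> set (colored_park v)" "q \<in> set (colored_park v)" "fst p \<le> fst q" "snd p \<noteq> snd q"
    for p q
  proof -
    obtain p' q' where p': "p' \<in> set v" "p = apfst ?f p'" and q': "q' \<in> set v" "q = apfst ?f q'"
      using pq(1,2) unfolding colored_park_eq[OF v0] by auto
    have letters: "fst p' \<in> set (letters v)" "fst q' \<in> set (letters v)" using p' q' by auto
    have "\<not> ?f (fst q') < ?f (fst p')" using pq(3) p' q' by simp
    then have "fst p' \<le> fst q'" using relabel_less_iff[OF letters(2,1) v0] by simp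
    moreover have "snd p' \<noteq> snd q'" using pq(4) p' q' by simp
    ultimately obtain b where b: "fst p' \<le> b" "b < fst q'" "cnt (letters w) b = b"
      using signedD[OF assms(1)] p'(1) q'(1) sub by (metis subsetD)
    have "fst q' \<in> set (letters w)" using q'(1) sub by auto
    then have "b \<le> length (letters w)" using parking_le_length[OF w] b(2) by force
    then have iff: "?f x \<le> cnt (letters v) b \<longleftrightarrow> x \<le> b" if "x \<in> set (letters v)" for x
      using relabel_le_break_iff[OF w _ b(3) subl that] by simp
    have eq: "filter (\<lambda>x. ?f x \<le> cnt (letters v) b) (letters v) = filter (\<lambda>x. x \<le> b) (letters v)"
      using iff by (intro filter_cong) auto
    have "cnt (map ?f (letters v)) (cnt (letters v) b) = cnt (letters v) b"
      unfolding cnt_map[of ?f] eq by (rule cnt_def[symmetric])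
    then have "cnt (letters (colored_park v)) (cnt (letters v) b) = cnt (letters v) b"
      unfolding colored_park_eq[OF v0] letters_recolor .
    moreover have "fst p \<le> cnt (letters v) b" using iff[OF letters(1)] b(1) p'(2) by simp
    moreover have "cnt (letters v) b < fst q" using iff[OF letters(2)] b(2) q'(2) by simp
    ultimately show ?thesis by blast
  qed
  moreover have "parking (letters (colored_park v))" by (rule parking_colored_park[OF w sub])
  ultimately show ?thesis by (simp add: signed_def)
qed

text \<open>Two letters on the same side of \<open>k\<close> are separated by a breakpoint of that
  part; for letters on different sides \<open>k\<close> itself separates.\<close>

lemma signed_of_low_high:
  assumes w: "parking (letters w)" "k \<in> breaks w" and low: "signed (low k w)"
    and high: "signed (high k w)"
  shows "signed w"
proof -
  have "\<exists>b. fst p \<le> b \<and> b < fst q \<and> cnt (letters w) b = b"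
    if pq: "p \<in> set w" "q \<in> set w" "fst p \<le> fst q" "snd p \<noteq> snd q" for p q
  proof -
    consider "fst q \<le> k" | "fst p \<le> k" "k < fst q" | "k < fst p" by linarith
    then show ?thesis
    proof cases
      case 1
      then have "p \<in> set (low k w)" "q \<in> set (low k w)" using pq by (auto simp: low_def)
      then obtain b where "fst p \<le> b" "b < fst q" "cnt (letters (low k w)) b = b"
        using signedD[OF low] pq by metis
      then show ?thesis using 1 by (auto simp: cnt_low)
    next
      case 2
      then show ?thesis using w(2) by auto
    next
      case 3
      then have k: "k < fst p" "k < fst q" using pq(3) by simp_all
      have "\<exists>b. fst p - k \<le> b \<and> b < fst q - k \<and> cnt (letters (high k w)) b = b"
        using signedD[OF high mem_high[OF pq(1) k(1)] mem_high[OF pq(2) k(2)]] pq(3,4)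
        by (simp add: diff_le_mono)
      then obtain b where "fst p - k \<le> b" "b < fst q - k" "cnt (letters (high k w)) b = b"
        by blast
      then have "fst p \<le> k + b" "k + b < fst q" "cnt (letters w) (k + b) = k + b"
        using w(2) by (auto simp: cnt_high)
      then show ?thesis by blast
    qed
  qed
  then show ?thesis using w(1) by (simp add: signed_def)
qed

lemma signed_high:
  assumes "signed w" "k \<in> breaks w"
  shows "signed (high k w)"
proof -
  have "\<exists>b. fst p \<le> b \<and> b < fst q \<and> cnt (letters (high k w)) b = b"
    if pq: "p \<in> set (high k w)" "q \<in> set (high k w)" "fst p \<le> fst q" "snd p \<noteq> snd q" for p q
  proof -
    have mem: "(k + fst p, snd p) \<in> set w" "(k + fst q, snd q) \<in> set w"
      using pq(1,2) by (auto simp: high_def)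
    have "\<exists>b. k + fst p \<le> b \<and> b < k + fst q \<and> cnt (letters w) b = b"
      using signedD[OF assms(1) mem] pq(3,4) by simp
    then obtain b where b: "k + fst p \<le> b" "b < k + fst q" "cnt (letters w) b = b"
      by blast
    then have "cnt (letters w) (k + (b - k)) = b" by simp
    then have "cnt (letters (high k w)) (b - k) = b - k"
      unfolding cnt_high using assms(2) by simp
    then show ?thesis using b by (intro exI[of _ "b - k"]) auto
  qed
  then show ?thesis
    using parking_high[OF _ assms(2)] assms(1) by (simp add: signed_def)
qed

lemma sorted_low_high:
  assumes "sorted (letters w)"
  shows "w = low k w @ shift k (high k w)"
  using assms
proof (induction w)
  case (Cons p w)
  show ?case
  proof (cases "fst p \<le> k")
    case True
    then show ?thesis using Cons by (simp add: low_def high_def)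
  next
    case False
    then have "\<forall>q\<in>set (p # w). k < fst q" using Cons.prems by (force simp: not_le)
    then have "low k (p # w) = []" "filter (\<lambda>q. k < fst q) (p # w) = p # w"
      by (auto simp: low_def not_le[symmetric] filter_empty_conv intro!: filter_True)
    moreover have "shift k (map (\<lambda>(x, c). (x - k, c)) v) = v" if "\<forall>q\<in>set v. k < fst q" for v
      using that by (induction v) (auto simp: shift_def)
    ultimately show ?thesis using \<open>\<forall>q\<in>set (p # w). k < fst q\<close> by (simp only: high_def append_Nil)
  qed
qed (simp add: low_def high_def)

text \<open>In one direction, prepending a monochromatic factor creates a cut at its length. In the
  other, the word is cut at its least positive breakpoint: minimality makes the lower part prime,
  and also monochromatic, as no breakpoint inside could separate two colors.\<close>

lemma signed_ndpf_eq: "signed_ndpf = {w. sorted (letters w) \<and> signed w}"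
proof (intro equalityI subsetI)
  fix w assume "w \<in> signed_ndpf"
  then obtain fs :: "(nat list \<times> bool) list"
    where fs: "w = shifted_concat (map (\<lambda>(a, c). map (\<lambda>x. (x, c)) a) fs)"
      "\<forall>(a, c) \<in> set fs. prime_parking a \<and> sorted a"
    unfolding signed_ndpf_def by blast
  have "sorted (letters (shifted_concat (map (\<lambda>(a, c). map (\<lambda>x. (x, c)) a) fs))) \<and>
      signed (shifted_concat (map (\<lambda>(a, c). map (\<lambda>x. (x, c)) a) fs))"
    using fs(2)
  proof (induction fs)
    case Nil
    then show ?case by (simp add: signed_def parking_cnt)
  next
    case (Cons f fs)
    obtain a c where f: "f = (a, c)" by (cases f)
    define v where "v = map (\<lambda>x. (x, c)) a"
    define w where "w = shifted_concat (map (\<lambda>(a, c). map (\<lambda>x. (x, c)) a) fs)"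
    have IH: "sorted (letters w)" "signed w" using Cons by (simp_all add: w_def)
    have a: "parking a" "sorted a" using Cons.prems by (auto simp: f prime_parking_def)
    have va: "letters v = a" by (simp add: v_def o_def)
    have v: "signed v" using a(1) by (auto simp: signed_def va) (auto simp: v_def)
    have pv: "parking (letters v)" and pw: "parking (letters w)"
      using v IH(2) by (simp_all add: signed_def)
    then have w0: "0 \<notin> set (letters w)" by (simp add: parking_cnt)
    let ?z = "v @ shift (length v) w"
    have mem: "?z \<in> shifted_shuffle v w" by (rule append_mem_shifted_shuffle[OF pv w0])
    then have z: "length v \<in> breaks ?z" "low (length v) ?z = v" "high (length v) ?z = w"
      using shifted_shuffle_iff[OF pv w0] by blast+
    have "signed ?z"
      using signed_of_low_high[OF parking_shifted_shuffle[OF pv pw mem] z(1)] z v IH(2) by simp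
    moreover have "sorted (letters ?z)"
    proof -
      have "sorted (map (\<lambda>x. x + length v) (letters w))"
        using IH(1) by (simp add: sorted_iff_nth_mono)
      moreover have "\<forall>x\<in>set a. x \<le> length v"
        using parking_le_length[OF a(1)] by (simp add: v_def)
      ultimately show ?thesis
        using a(2) unfolding map_append letters_shift va sorted_append by fastforce
    qed
    ultimately show ?case by (simp add: f v_def w_def)
  qed
  then show "w \<in> {w. sorted (letters w) \<and> signed w}" by (simp add: fs(1))
next
  fix w assume "w \<in> {w. sorted (letters w) \<and> signed w}"
  then have "sorted (letters w)" "signed w" by simp_all
  then show "w \<in> signed_ndpf"
  proof (induction "length w" arbitrary: w rule: less_induct)
    case less
    show ?case
    proof (cases "w = []")
      case True
      then have "w = shifted_concat (map (\<lambda>(a, c). map (\<lambda>x. (x, c)) a) [])" by simp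
      then show ?thesis unfolding signed_ndpf_def by fastforce
    next
      case False
      have park: "parking (letters w)" using less.prems(2) by (simp add: signed_def)
      \<comment> \<open>The bound \<open>1 \<le> b\<close> excludes the trivial breakpoint
        \<open>0\<close>, which would split off the empty word.\<close>
      let ?P = "\<lambda>b. 1 \<le> b \<and> cnt (letters w) b = b"
      define k where "k = (LEAST b. ?P b)"
      have P: "?P (length w)"
        using False parking_cnt_length[OF park] by (simp add: Suc_le_eq)
      then have k: "?P k" unfolding k_def by (rule LeastI)
      have "k \<le> length w" unfolding k_def using P by (rule Least_le)
      then have brk: "k \<in> breaks w" using k by simp
      have least: "\<not> ?P b" if "b < k" for b
        using that not_less_Least[of b ?P] by (simp add: k_def)
      let ?v = "low k w" and ?w = "high k w"
      define c where "c = snd (hd ?v)"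
      have len: "length ?v = k" using k by (simp add: length_low)
      \<comment> \<open>A separating breakpoint would be positive, being at least a letter, and
        smaller than \<open>k\<close>, against the choice of \<open>k\<close>.\<close>
      have color: "snd p = snd q" if pq: "p \<in> set ?v" "q \<in> set ?v" "fst p \<le> fst q" for p q
      proof (rule ccontr)
        assume "snd p \<noteq> snd q"
        moreover have "p \<in> set w" "q \<in> set w" using pq by (simp_all add: low_def)
        ultimately obtain b where b: "fst p \<le> b" "b < fst q" "cnt (letters w) b = b"
          using signedD[OF less.prems(2) _ _ pq(3)] by blast
        have "fst p \<in> set (letters w)" using pq(1) by (auto simp: low_def)
        then have "fst p \<noteq> 0" using park unfolding parking_cnt by metis
        then have "?P b" using b by simp
        moreover have "b < k" using b(2) pq(2) by (simp add: low_def)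
        ultimately show False using least by blast
      qed
      have "?v \<noteq> []" using len k by force
      then have "snd p = c" if "p \<in> set ?v" for p
        using color[of p "hd ?v"] color[of "hd ?v" p] that unfolding c_def
        by (metis hd_in_set nat_le_linear)
      then have v: "?v = map (\<lambda>x. (x, c)) (letters ?v)"
        by (auto simp: o_def intro!: map_idI[symmetric])
      have eq_k: "b = k" if "b \<in> {1..k}" "cnt (letters ?v) b = b" for b
        using least[of b] that by (cases "b < k") (auto simp: cnt_low min_def)
      have "{b \<in> {1..k}. cnt (letters ?v) b = b} = {k}"
        using eq_k k by (auto simp: cnt_low)
      then have prime: "prime_parking (letters ?v)"
        using parking_low[OF park brk] by (simp add: prime_parking_def cnt_conv_card len)
      have sorted_v: "sorted (letters ?v)"
        using less.prems(1) unfolding low_def by (rule sorted_filter)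
      have "sorted (map (\<lambda>x. x - k) (letters (filter (\<lambda>p. k < fst p) w)))"
        using sorted_filter[OF less.prems(1)] by (auto simp: sorted_iff_nth_mono diff_le_mono)
      then have "sorted (letters ?w)" by (simp add: high_def o_def case_prod_beta)
      moreover have "length ?w < length w"
        using conjunct1[OF k] conjunct2[OF k] \<open>k \<le> length w\<close> by (simp add: length_high)
      ultimately have "?w \<in> signed_ndpf"
        using less.hyps signed_high[OF less.prems(2) brk] by blast
      then obtain fs :: "(nat list \<times> bool) list"
        where fs: "?w = shifted_concat (map (\<lambda>(a, c). map (\<lambda>x. (x, c)) a) fs)"
          "\<forall>(a, c) \<in> set fs. prime_parking a \<and> sorted a"
        unfolding signed_ndpf_def by blast
      have "w = shifted_concat (map (\<lambda>(a, c). map (\<lambda>x. (x, c)) a) ((letters ?v, c) # fs))"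
        using sorted_low_high[OF less.prems(1), of k] v len by (simp add: fs(1)[symmetric])
      moreover have "\<forall>(a, c) \<in> set ((letters ?v, c) # fs). prime_parking a \<and> sorted a"
        using fs(2) prime sorted_v by simp
      ultimately show ?thesis unfolding signed_ndpf_def by blast
    qed
  qed
qed

section \<open>Nondecreasing rearrangement\<close>

lemma mset_nondec [simp]: "mset (nondec w) = mset w"
  by (simp add: nondec_def)

lemma nondec_in_signed_ndpf: "nondec w \<in> signed_ndpf \<longleftrightarrow> signed w"
  using signed_cong_mset[OF mset_nondec, of w] by (simp add: signed_ndpf_eq nondec_def)

text \<open>Stable sorting remembers the input order only among biletters with the same letter. In a
  signed word these coincide, so the result depends on the multiset alone.\<close>

lemma nondec_eq_iff:
  assumes "\<pi> \<in> signed_ndpf"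
  shows "nondec w = \<pi> \<longleftrightarrow> mset w = mset \<pi>"
proof
  assume "mset w = mset \<pi>"
  moreover have "sorted (letters \<pi>)" "signed \<pi>" using assms by (simp_all add: signed_ndpf_eq)
  moreover from this have "inj_on fst (set \<pi>)"
    by (intro inj_onI prod_eqI) (auto dest: signedD)
  ultimately show "nondec w = \<pi>"
    unfolding nondec_def by (intro sort_key_inj_key_eq) (auto dest: mset_eq_setD)
qed auto

section \<open>The bialgebra of 2-colored parking functions\<close>

abbreviation deg_pf :: "colored_pf \<Rightarrow> nat" where
  "deg_pf w \<equiv> length (Rep_colored_pf w)"

lemma parking_Rep: "parking (letters (Rep_colored_pf w))"
  using Rep_colored_pf by simp

lemma zero_notin_Rep: "0 \<notin> set (letters (Rep_colored_pf w))"
  using parking_Rep by (simp add: parking_cnt)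

lemma Rep_Abs: "parking (letters w) \<Longrightarrow> Rep_colored_pf (Abs_colored_pf w) = w"
  by (simp add: Abs_colored_pf_inverse)

lemma colored_pf_eqI: "Rep_colored_pf v = Rep_colored_pf w \<Longrightarrow> v = w"
  by (simp add: Rep_colored_pf_inject)

lemma deg_park_take [simp]: "deg_pf (park_take i w) = min (deg_pf w) i"
  and deg_park_drop [simp]: "deg_pf (park_drop i w) = deg_pf w - i"
  by (simp_all add: park_take.rep_eq park_drop.rep_eq)

lemma deg_empty [simp]: "deg_pf empty_pf = 0"
  by (simp add: empty_pf.rep_eq)

lemma deg_0_iff: "deg_pf w = 0 \<longleftrightarrow> w = empty_pf"
  by (auto intro: colored_pf_eqI simp: empty_pf.rep_eq)

lemma finite_deg: "finite {w. deg_pf w = n}"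
proof -
  have "Rep_colored_pf ` {w. deg_pf w = n} \<subseteq> {xs. set xs \<subseteq> {1..n} \<times> UNIV \<and> length xs = n}"
  proof (rule image_subsetI)
    fix w assume w: "w \<in> {w. deg_pf w = n}"
    then have "set (letters (Rep_colored_pf w)) \<subseteq> {1..n}"
      using parking_Rep[of w] by (simp add: parking_def)
    then show "Rep_colored_pf w \<in> {xs. set xs \<subseteq> {1..n} \<times> UNIV \<and> length xs = n}"
      using w by force
  qed
  then have "finite (Rep_colored_pf ` {w. deg_pf w = n})"
    by (rule finite_subset) (simp add: finite_lists_length_eq)
  then show ?thesis by (rule finite_imageD) (simp add: inj_on_def Rep_colored_pf_inject)
qed

section \<open>Coefficients of products\<close>

definition low_pf :: "nat \<Rightarrow> colored_pf \<Rightarrow> colored_pf" where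
  "low_pf k w = Abs_colored_pf (low k (Rep_colored_pf w))"

text \<open>Away from breakpoints the upper part need not be a parking function, and the value may
  be unspecified.\<close>

definition high_pf :: "nat \<Rightarrow> colored_pf \<Rightarrow> colored_pf" where
  "high_pf k w = Abs_colored_pf (high k (Rep_colored_pf w))"

abbreviation breaks_pf :: "colored_pf \<Rightarrow> nat set" where
  "breaks_pf w \<equiv> breaks (Rep_colored_pf w)"

lemma Rep_low_pf: "k \<in> breaks_pf w \<Longrightarrow> Rep_colored_pf (low_pf k w) = low k (Rep_colored_pf w)"
  unfolding low_pf_def by (intro Rep_Abs parking_low parking_Rep)

lemma Rep_high_pf: "k \<in> breaks_pf w \<Longrightarrow> Rep_colored_pf (high_pf k w) = high k (Rep_colored_pf w)"
  unfolding high_pf_def by (intro Rep_Abs parking_high parking_Rep)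

lemma deg_low_pf: "k \<in> breaks_pf w \<Longrightarrow> deg_pf (low_pf k w) = k"
  by (simp add: Rep_low_pf length_low)

lemma deg_high_pf: "k \<in> breaks_pf w \<Longrightarrow> deg_pf (high_pf k w) = deg_pf w - k"
  by (simp add: Rep_high_pf length_high)

lemma mem_breaks_low: "k \<in> breaks_pf w \<Longrightarrow> j \<in> breaks_pf (low_pf k w) \<longleftrightarrow> j \<le> k \<and> j \<in> breaks_pf w"
  by (auto simp: Rep_low_pf length_low cnt_low min_def)

lemma mem_breaks_high: "k \<in> breaks_pf w \<Longrightarrow> j \<in> breaks_pf (high_pf k w) \<longleftrightarrow> k + j \<in> breaks_pf w"
  by (auto simp: Rep_high_pf length_high cnt_high)

lemma finite_breaks [simp]: "finite (breaks_pf w)"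
  by (rule finite_subset[of _ "{..deg_pf w}"]) auto

lemma shifted_shuffle_pf_iff:
  "Rep_colored_pf z \<in> shifted_shuffle (Rep_colored_pf v) (Rep_colored_pf w) \<longleftrightarrow>
     deg_pf v \<in> breaks_pf z \<and> low_pf (deg_pf v) z = v \<and> high_pf (deg_pf v) z = w"
  unfolding shifted_shuffle_iff[OF parking_Rep zero_notin_Rep]
proof (cases "deg_pf v \<in> breaks_pf z")
  case True
  show "deg_pf v \<in> breaks_pf z \<and> low (deg_pf v) (Rep_colored_pf z) = Rep_colored_pf v \<and>
      high (deg_pf v) (Rep_colored_pf z) = Rep_colored_pf w \<longleftrightarrow>
    deg_pf v \<in> breaks_pf z \<and> low_pf (deg_pf v) z = v \<and> high_pf (deg_pf v) z = w"
    unfolding Rep_low_pf[OF True, symmetric] Rep_high_pf[OF True, symmetric]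
      Rep_colored_pf_inject by (rule refl)
qed blast

lemma finite_shifted_shuffle: "finite (shifted_shuffle v w)"
  by (simp add: shifted_shuffle_def)

lemma finite_shifted_shuffle_pf: "finite {z. Rep_colored_pf z \<in> shifted_shuffle v w}"
proof (rule finite_imageD)
  show "finite (Rep_colored_pf ` {z. Rep_colored_pf z \<in> shifted_shuffle v w})"
    by (rule finite_subset[OF _ finite_shifted_shuffle]) auto
qed (simp add: inj_on_def Rep_colored_pf_inject)

lemma lookup_PQ_mult:
  fixes x :: "colored_pf \<times> colored_pf \<Rightarrow>\<^sub>0 'k::field"
  shows "Poly_Mapping.lookup (PQ_mult x) z =
     (\<Sum>k\<in>breaks_pf z. Poly_Mapping.lookup x (low_pf k z, high_pf k z))"
proof -
  let ?h = "\<lambda>k. (low_pf k z, high_pf k z)"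
  \<comment> \<open>Different breakpoints give different pairs because the first component has
    length \<open>k\<close>; the sum over breakpoints therefore counts each pair once.\<close>
  have inj: "inj_on ?h (breaks_pf z)"
  proof (rule inj_onI)
    fix k j assume k: "k \<in> breaks_pf z" and j: "j \<in> breaks_pf z" and "?h k = ?h j"
    then have "deg_pf (low_pf k z) = deg_pf (low_pf j z)" by simp
    then show "k = j" unfolding deg_low_pf[OF k] deg_low_pf[OF j] .
  qed
  have mem: "p \<in> ?h ` breaks_pf z \<longleftrightarrow>
      Rep_colored_pf z \<in> shifted_shuffle (Rep_colored_pf (fst p)) (Rep_colored_pf (snd p))" for p
    unfolding shifted_shuffle_pf_iff
  proof
    assume "p \<in> ?h ` breaks_pf z"
    then obtain k where k: "p = ?h k" "k \<in> breaks_pf z" by (rule imageE)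
    show "deg_pf (fst p) \<in> breaks_pf z \<and> low_pf (deg_pf (fst p)) z = fst p \<and>
        high_pf (deg_pf (fst p)) z = snd p"
      using k(2) unfolding k(1) fst_conv snd_conv deg_low_pf[OF k(2)] by simp
  next
    assume "deg_pf (fst p) \<in> breaks_pf z \<and> low_pf (deg_pf (fst p)) z = fst p \<and>
      high_pf (deg_pf (fst p)) z = snd p"
    then show "p \<in> ?h ` breaks_pf z" by (intro image_eqI[of p ?h "deg_pf (fst p)"]) simp_all
  qed
  have "Poly_Mapping.lookup (\<Sum>z | Rep_colored_pf z \<in>
      shifted_shuffle (Rep_colored_pf (fst p)) (Rep_colored_pf (snd p)). bvec z :: _ \<Rightarrow>\<^sub>0 'k) z =
      (if p \<in> ?h ` breaks_pf z then 1 else 0)" for p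
    unfolding mem by (simp add: lookup_sum lookup_single when_def finite_shifted_shuffle_pf)
  then have "Poly_Mapping.lookup (PQ_mult x) z = (\<Sum>p\<in>Poly_Mapping.keys x.
      Poly_Mapping.lookup x p * (if p \<in> ?h ` breaks_pf z then 1 else 0))"
    unfolding PQ_mult_def lookup_lin_ext case_prod_beta by (intro sum.cong) simp_all
  also have "\<dots> = (\<Sum>p\<in>Poly_Mapping.keys x \<inter> ?h ` breaks_pf z. Poly_Mapping.lookup x p)"
    by (simp add: sum.inter_restrict if_distrib cong: if_cong)
  also have "\<dots> = (\<Sum>p\<in>?h ` breaks_pf z. Poly_Mapping.lookup x p)"
    by (rule sum.mono_neutral_left) (auto simp: in_keys_iff)
  also have "\<dots> = (\<Sum>k\<in>breaks_pf z. Poly_Mapping.lookup x (?h k))"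
    by (simp add: sum.reindex[OF inj])
  finally show ?thesis .
qed

section \<open>Coefficients of coproducts\<close>

lemma PQ_comult_bvec:
  "PQ_comult (bvec w) = (\<Sum>i\<le>deg_pf w. bvec (park_take i w, park_drop i w))"
  by (simp add: PQ_comult_def atMost_atLeast0)

text \<open>The indices \<open>w\<close> for which the coproduct of \<open>bvec w\<close> contains
  \<open>(p, q)\<close>. The cut can only be at \<open>deg_pf p\<close>, so the multiplicity is
  one.\<close>

definition splits :: "colored_pf \<Rightarrow> colored_pf \<Rightarrow> colored_pf set" where
  "splits p q = {w. deg_pf w = deg_pf p + deg_pf q \<and> park_take (deg_pf p) w = p \<and>
     park_drop (deg_pf p) w = q}"

lemma finite_splits: "finite (splits p q)"
  by (rule finite_subset[OF _ finite_deg[of "deg_pf p + deg_pf q"]]) (auto simp: splits_def)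

lemma lookup_PQ_comult_bvec:
  "Poly_Mapping.lookup (PQ_comult (bvec w)) (p, q) = (if w \<in> splits p q then 1 else 0)"
proof -
  have "(park_take i w, park_drop i w) = (p, q) \<longleftrightarrow> i = deg_pf p \<and> w \<in> splits p q"
    if "i \<le> deg_pf w" for i
    using that by (auto simp: splits_def)
  then have "Poly_Mapping.lookup (PQ_comult (bvec w)) (p, q) =
      (\<Sum>i\<le>deg_pf w. if i = deg_pf p \<and> w \<in> splits p q then 1 else 0)"
    unfolding PQ_comult_bvec lookup_sum lookup_single when_def by (intro sum.cong) auto
  also have "\<dots> = (if w \<in> splits p q then 1 else 0)"
    by (auto simp: splits_def)
  finally show ?thesis .
qed

lemma flinear_PQ_mult [simp]: "flinear PQ_mult" and flinear_PQ_comult [simp]: "flinear PQ_comult"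
  by (simp_all add: PQ_mult_def PQ_comult_def)

lemma lookup_PQ_comult:
  "Poly_Mapping.lookup (PQ_comult x) (p, q) = (\<Sum>w\<in>splits p q. Poly_Mapping.lookup x w)"
proof -
  have "Poly_Mapping.lookup (PQ_comult x) (p, q) = (\<Sum>w\<in>Poly_Mapping.keys x.
      Poly_Mapping.lookup x w * (if w \<in> splits p q then 1 else 0))"
    by (subst flinear_eq_lin_ext[OF flinear_PQ_comult])
      (simp add: lookup_lin_ext lookup_PQ_comult_bvec)
  also have "\<dots> = (\<Sum>w\<in>Poly_Mapping.keys x \<inter> splits p q. Poly_Mapping.lookup x w)"
    by (simp add: sum.inter_restrict if_distrib cong: if_cong)
  also have "\<dots> = (\<Sum>w\<in>splits p q. Poly_Mapping.lookup x w)"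
    by (rule sum.mono_neutral_left) (auto simp: in_keys_iff finite_splits)
  finally show ?thesis .
qed

text \<open>Both coefficients are sums over pairs of breakpoints \<open>j \<le> k\<close> of the
  same word, which cut it into three pieces; only the order of the two cuts differs.\<close>

lemma PQ_mult_assoc:
  "PQ_mult (tensor (PQ_mult (tensor x y)) z) = PQ_mult (tensor x (PQ_mult (tensor y z)))"
proof (rule poly_mapping_eqI)
  fix t
  let ?g = "\<lambda>j k. Poly_Mapping.lookup x (low_pf j t) *
    Poly_Mapping.lookup y (low_pf (k - j) (high_pf j t)) * Poly_Mapping.lookup z (high_pf k t)"
  have low: "low_pf j (low_pf k t) = low_pf j t"
      "high_pf j (low_pf k t) = low_pf (k - j) (high_pf j t)"
    if "k \<in> breaks_pf t" "j \<in> breaks_pf (low_pf k t)" for j k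
  proof -
    have j: "j \<le> k" "j \<in> breaks_pf t" using that mem_breaks_low by blast+
    show "low_pf j (low_pf k t) = low_pf j t"
      unfolding low_pf_def[of j] Rep_low_pf[OF that(1)] by (simp add: low_low j)
    show "high_pf j (low_pf k t) = low_pf (k - j) (high_pf j t)"
      unfolding high_pf_def[of j "low_pf k t"] low_pf_def[of "k - j"] Rep_low_pf[OF that(1)]
        Rep_high_pf[OF j(2)] by (simp add: high_low j)
  qed
  have high: "high_pf i (high_pf j t) = high_pf (j + i) t" if "j \<in> breaks_pf t" for i j
    unfolding high_pf_def[of i] Rep_high_pf[OF that]
    by (simp add: high_high high_pf_def add.commute)
  have "Poly_Mapping.lookup (PQ_mult (tensor (PQ_mult (tensor x y)) z)) t =
      (\<Sum>k\<in>breaks_pf t. \<Sum>j\<in>breaks_pf (low_pf k t). ?g j k)"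
    by (simp only: lookup_PQ_mult lookup_tensor sum_distrib_right low cong: sum.cong)
  also have "\<dots> = (\<Sum>j\<in>breaks_pf t. \<Sum>i\<in>breaks_pf (high_pf j t). ?g j (j + i))"
    unfolding sum.Sigma[OF finite_breaks ballI[OF finite_breaks]]
  proof (rule sum.reindex_bij_witness[of _ "\<lambda>(j, i). (j + i, j)" "\<lambda>(k, j). (j, k - j)"])
    fix a assume "a \<in> Sigma (breaks_pf t) (\<lambda>k. breaks_pf (low_pf k t))"
    then obtain k j where a: "a = (k, j)" "k \<in> breaks_pf t" "j \<in> breaks_pf (low_pf k t)" by blast
    then have j: "j \<le> k" "j \<in> breaks_pf t" using mem_breaks_low by blast+
    then have "j + (k - j) = k" by simp
    then have "k - j \<in> breaks_pf (high_pf j t)"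
      using mem_breaks_high[OF j(2), of "k - j"] a(2) by simp
    then show "(case a of (k, j) \<Rightarrow> (j, k - j)) \<in> Sigma (breaks_pf t) (\<lambda>j. breaks_pf (high_pf j t))"
      using a j by simp
    show "(case case a of (k, j) \<Rightarrow> (j, k - j) of (j, i) \<Rightarrow> (j + i, j)) = a"
      using a j by simp
    show "(case case a of (k, j) \<Rightarrow> (j, k - j) of (j, i) \<Rightarrow> ?g j (j + i)) =
        (case a of (k, j) \<Rightarrow> ?g j k)"
      using a j by simp
  next
    fix b assume "b \<in> Sigma (breaks_pf t) (\<lambda>j. breaks_pf (high_pf j t))"
    then obtain j i where b: "b = (j, i)" "j \<in> breaks_pf t" "i \<in> breaks_pf (high_pf j t)" by blast
    then have k: "j + i \<in> breaks_pf t" using mem_breaks_high by blast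
    have "j \<in> breaks_pf (low_pf (j + i) t)" using mem_breaks_low[OF k, of j] b(2) by simp
    then show "(case b of (j, i) \<Rightarrow> (j + i, j)) \<in> Sigma (breaks_pf t) (\<lambda>k. breaks_pf (low_pf k t))"
      using b(1) k by simp
    show "(case case b of (j, i) \<Rightarrow> (j + i, j) of (k, j) \<Rightarrow> (j, k - j)) = b"
      by (simp add: b(1))
  qed
  also have "\<dots> = (\<Sum>j\<in>breaks_pf t. \<Sum>i\<in>breaks_pf (high_pf j t).
      Poly_Mapping.lookup x (low_pf j t) * (Poly_Mapping.lookup y (low_pf i (high_pf j t)) *
        Poly_Mapping.lookup z (high_pf i (high_pf j t))))"
    by (intro sum.cong refl) (simp only: high, simp add: mult.assoc)
  also have "\<dots> = Poly_Mapping.lookup (PQ_mult (tensor x (PQ_mult (tensor y z)))) t"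
    by (simp only: lookup_PQ_mult lookup_tensor sum_distrib_left)
  finally show "Poly_Mapping.lookup (PQ_mult (tensor (PQ_mult (tensor x y)) z)) t =
      Poly_Mapping.lookup (PQ_mult (tensor x (PQ_mult (tensor y z)))) t" .
qed

section \<open>The unit and the trivial cuts\<close>

lemma zero_mem_breaks: "0 \<in> breaks_pf w"
  using zero_notin_Rep[of w] by (simp add: cnt_0)

lemma deg_mem_breaks: "deg_pf w \<in> breaks_pf w"
  using parking_cnt_length[OF parking_Rep, of w] by simp

lemma high_pf_0: "high_pf 0 w = w"
proof -
  have "high 0 (Rep_colored_pf w) = Rep_colored_pf w"
    using zero_notin_Rep[of w] unfolding high_def by (subst filter_True) force+
  then show ?thesis by (simp add: high_pf_def Rep_colored_pf_inverse)
qed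

lemma low_pf_deg: "low_pf (deg_pf w) w = w"
proof -
  have "low (deg_pf w) (Rep_colored_pf w) = Rep_colored_pf w"
    using parking_le_length[OF parking_Rep, of _ w] unfolding low_def by (intro filter_True) simp
  then show ?thesis by (simp add: low_pf_def Rep_colored_pf_inverse)
qed

lemma low_pf_eq_empty:
  assumes "k \<in> breaks_pf w"
  shows "empty_pf = low_pf k w \<longleftrightarrow> k = 0"
  using deg_0_iff[of "low_pf k w"] unfolding deg_low_pf[OF assms] by auto

lemma high_pf_eq_empty:
  assumes "k \<in> breaks_pf w"
  shows "empty_pf = high_pf k w \<longleftrightarrow> k = deg_pf w"
  using deg_0_iff[of "high_pf k w"] assms unfolding deg_high_pf[OF assms] by auto

lemma PQ_unit_left: "PQ_mult (tensor PQ_one x) = x"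
proof (rule poly_mapping_eqI)
  fix z
  have "Poly_Mapping.lookup (PQ_mult (tensor PQ_one x)) z =
      (\<Sum>k\<in>breaks_pf z. if k = 0 then Poly_Mapping.lookup x (high_pf k z) else 0)"
    unfolding lookup_PQ_mult lookup_tensor PQ_one_def lookup_single when_def
    by (intro sum.cong refl) (simp only: low_pf_eq_empty, simp)
  then show "Poly_Mapping.lookup (PQ_mult (tensor PQ_one x)) z = Poly_Mapping.lookup x z"
    using zero_mem_breaks[of z] by (simp add: high_pf_0)
qed

lemma PQ_unit_right: "PQ_mult (tensor x PQ_one) = x"
proof (rule poly_mapping_eqI)
  fix z
  have "Poly_Mapping.lookup (PQ_mult (tensor x PQ_one)) z =
      (\<Sum>k\<in>breaks_pf z. if k = deg_pf z then Poly_Mapping.lookup x (low_pf k z) else 0)"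
    unfolding lookup_PQ_mult lookup_tensor PQ_one_def lookup_single when_def
    by (intro sum.cong refl) (simp only: high_pf_eq_empty, simp)
  then show "Poly_Mapping.lookup (PQ_mult (tensor x PQ_one)) z = Poly_Mapping.lookup x z"
    using deg_mem_breaks[of z] by (simp add: low_pf_deg)
qed

section \<open>Iterated deconcatenation, coassociativity and the counit\<close>

lemma park_take_all: "deg_pf w \<le> i \<Longrightarrow> park_take i w = w"
  by (rule colored_pf_eqI) (simp add: park_take.rep_eq colored_park_parking parking_Rep)

lemma park_drop_0: "park_drop 0 w = w"
  by (rule colored_pf_eqI) (simp add: park_drop.rep_eq colored_park_parking parking_Rep)

lemma zero_notin_take: "0 \<notin> set (letters (take i (Rep_colored_pf w)))"
  and zero_notin_drop: "0 \<notin> set (letters (drop i (Rep_colored_pf w)))"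
  using zero_notin_Rep[of w] by (auto dest: in_set_takeD in_set_dropD)

lemma park_take_take: "j \<le> i \<Longrightarrow> park_take j (park_take i w) = park_take j w"
  by (rule colored_pf_eqI)
    (unfold park_take.rep_eq colored_park_take[OF zero_notin_take], simp)

lemma park_drop_drop: "park_drop j (park_drop i w) = park_drop (i + j) w"
  by (rule colored_pf_eqI)
    (unfold park_drop.rep_eq colored_park_drop[OF zero_notin_drop], simp add: add.commute)

lemma park_drop_take: "park_drop j (park_take i w) = park_take (i - j) (park_drop j w)"
  by (rule colored_pf_eqI)
    (unfold park_drop.rep_eq park_take.rep_eq colored_park_drop[OF zero_notin_take]
      colored_park_take[OF zero_notin_drop], simp add: drop_take)

lemma park_take_eq_empty:
  assumes "i \<le> deg_pf w"
  shows "park_take i w = empty_pf \<longleftrightarrow> i = 0"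
  using deg_0_iff[of "park_take i w"] assms unfolding deg_park_take by auto

lemma park_drop_eq_empty:
  assumes "i \<le> deg_pf w"
  shows "park_drop i w = empty_pf \<longleftrightarrow> i = deg_pf w"
  using deg_0_iff[of "park_drop i w"] assms unfolding deg_park_drop by auto

text \<open>Both sides cut a word at positions \<open>j \<le> i\<close>; the intermediate
  parkizations disappear, so only the order of summation remains to be exchanged.\<close>

lemma PQ_coassoc:
  fixes x :: "colored_pf \<Rightarrow>\<^sub>0 'k::field"
  shows "tensor_assoc (tensor_map PQ_comult id (PQ_comult x)) = tensor_map id PQ_comult (PQ_comult x)"
proof (rule flinear_eqI[of "\<lambda>x. tensor_assoc (tensor_map PQ_comult id (PQ_comult x))"
      "\<lambda>x. tensor_map id PQ_comult (PQ_comult x)"])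
  fix w
  let ?n = "deg_pf w" and ?w = "bvec w :: colored_pf \<Rightarrow>\<^sub>0 'k"
  let ?g = "\<lambda>j i. bvec (park_take j w, park_take (i - j) (park_drop j w), park_drop i w) ::
    colored_pf \<times> colored_pf \<times> colored_pf \<Rightarrow>\<^sub>0 'k"
  have assoc: "tensor_assoc (bvec ((a, b), c)) = bvec (a, b, c)" for a b c
    by (simp add: tensor_assoc_def)
  have "tensor_assoc (tensor_map PQ_comult id (PQ_comult ?w)) =
      (\<Sum>i\<le>?n. \<Sum>j\<le>min ?n i.
        bvec (park_take j (park_take i w), park_drop j (park_take i w), park_drop i w))"
    by (simp add: PQ_comult_bvec flinear_sum[OF flinear_tensor_map] tensor_map_bvec
        flinear_sum[OF flinear_tensor_left] flinear_sum[OF flinear_tensor_assoc] assoc)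
  also have "\<dots> = (\<Sum>i\<le>?n. \<Sum>j\<le>i. ?g j i)"
    by (intro sum.cong) (simp_all add: park_take_take park_drop_take)
  also have "\<dots> = (\<Sum>j\<le>?n. \<Sum>i\<le>?n - j. ?g j (j + i))"
    unfolding sum.Sigma[OF finite_atMost ballI[OF finite_atMost]]
    by (rule sum.reindex_bij_witness[of _ "\<lambda>(j, i). (j + i, j)" "\<lambda>(i, j). (j, i - j)"]) auto
  also have "\<dots> = tensor_map id PQ_comult (PQ_comult ?w)"
    by (simp add: PQ_comult_bvec flinear_sum[OF flinear_tensor_map] tensor_map_bvec
        flinear_sum[OF flinear_tensor_right] park_drop_drop)
  finally show "tensor_assoc (tensor_map PQ_comult id (PQ_comult ?w)) =
      tensor_map id PQ_comult (PQ_comult ?w)" .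
qed (simp_all add: flinear_compose)

lemma PQ_counit_bvec: "PQ_counit (bvec a) = (if a = empty_pf then 1 else 0)"
  by (simp add: PQ_counit_def lookup_single when_def)

lemma PQ_counit_left:
  fixes x :: "colored_pf \<Rightarrow>\<^sub>0 'k::field"
  shows "lin_ext (\<lambda>(a, b). fscale (PQ_counit (bvec a)) (bvec b)) (PQ_comult x) = x"
proof (rule flinear_eqI[of "\<lambda>x. lin_ext _ (PQ_comult x)"])
  fix w
  have "lin_ext (\<lambda>(a, b). fscale (PQ_counit (bvec a)) (bvec b)) (PQ_comult (bvec w :: _ \<Rightarrow>\<^sub>0 'k)) =
      (\<Sum>i\<le>deg_pf w. if i = 0 then bvec (park_drop i w) else 0)"
    unfolding PQ_comult_bvec flinear_sum[OF flinear_lin_ext] lin_ext_bvec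
    by (intro sum.cong refl) (auto simp: PQ_counit_bvec park_take_eq_empty park_drop_eq_empty)
  then show "lin_ext (\<lambda>(a, b). fscale (PQ_counit (bvec a)) (bvec b)) (PQ_comult (bvec w)) =
      (bvec w :: _ \<Rightarrow>\<^sub>0 'k)"
    by (simp add: park_drop_0)
qed simp_all

lemma PQ_counit_right:
  fixes x :: "colored_pf \<Rightarrow>\<^sub>0 'k::field"
  shows "lin_ext (\<lambda>(a, b). fscale (PQ_counit (bvec b)) (bvec a)) (PQ_comult x) = x"
proof (rule flinear_eqI[of "\<lambda>x. lin_ext _ (PQ_comult x)"])
  fix w
  have "lin_ext (\<lambda>(a, b). fscale (PQ_counit (bvec b)) (bvec a)) (PQ_comult (bvec w :: _ \<Rightarrow>\<^sub>0 'k)) =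
      (\<Sum>i\<le>deg_pf w. if i = deg_pf w then bvec (park_take i w) else 0)"
    unfolding PQ_comult_bvec flinear_sum[OF flinear_lin_ext] lin_ext_bvec
    by (intro sum.cong refl) (auto simp: PQ_counit_bvec park_take_eq_empty park_drop_eq_empty)
  then show "lin_ext (\<lambda>(a, b). fscale (PQ_counit (bvec b)) (bvec a)) (PQ_comult (bvec w)) =
      (bvec w :: _ \<Rightarrow>\<^sub>0 'k)"
    by (simp add: park_take_all)
qed simp_all

text \<open>Cutting a shuffle leaves a shuffle of two prefixes followed by a shuffle of the two
  suffixes. The prefix lengths \<open>i\<close> and \<open>j\<close> are recovered by counting
  letters of each kind before the cut.\<close>

lemma sum_split_shuffles:
  assumes v: "\<forall>p\<in>set v. P p" and w: "\<forall>p\<in>set w. \<not> P p"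
  shows "(\<Sum>z\<in>shuffles v w. \<Sum>n\<le>length z. h (take n z) (drop n z)) =
    (\<Sum>i\<le>length v. \<Sum>j\<le>length w. \<Sum>s\<in>shuffles (take i v) (take j w).
      \<Sum>t\<in>shuffles (drop i v) (drop j w). h s t)"
proof -
  have tv: "\<forall>p\<in>set (take i v). P p" "\<forall>p\<in>set (drop i v). P p" for i
    using v by (auto dest: in_set_takeD in_set_dropD)
  have tw: "\<forall>p\<in>set (take i w). \<not> P p" "\<forall>p\<in>set (drop i w). \<not> P p" for i
    using w by (auto dest: in_set_takeD in_set_dropD)
  note iff = mem_shuffles_iff[OF v w] mem_shuffles_iff[OF tv(1) tw(1)]
    mem_shuffles_iff[OF tv(2) tw(2)]
  let ?N = "\<lambda>p. \<not> P p"
  let ?A = "Sigma (shuffles v w) (\<lambda>z. {..length z})"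
  let ?B = "Sigma {..length v} (\<lambda>i. Sigma {..length w} (\<lambda>j.
    shuffles (take i v) (take j w) \<times> shuffles (drop i v) (drop j w)))"
  have "(\<Sum>(z, n)\<in>?A. h (take n z) (drop n z)) = (\<Sum>(i, j, s, t)\<in>?B. h s t)"
  proof (rule sum.reindex_bij_witness[of _ "\<lambda>(i, j, s, t). (s @ t, length s)"
        "\<lambda>(z, n). (length (filter P (take n z)), length (filter ?N (take n z)), take n z, drop n z)"])
    fix a assume "a \<in> ?A"
    then obtain z n where a: "a = (z, n)" "filter P z = v" "filter ?N z = w" "n \<le> length z"
      using iff(1) by auto
    have split: "filter Q z = filter Q (take n z) @ filter Q (drop n z)" for Q
      by (metis append_take_drop_id filter_append)
    have "v = filter P (take n z) @ filter P (drop n z)"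
      "w = filter ?N (take n z) @ filter ?N (drop n z)"
      using split[of P] split[of ?N] a by simp_all
    then have "take (length (filter P (take n z))) v = filter P (take n z)"
      "drop (length (filter P (take n z))) v = filter P (drop n z)"
      "take (length (filter ?N (take n z))) w = filter ?N (take n z)"
      "drop (length (filter ?N (take n z))) w = filter ?N (drop n z)"
      "length (filter P (take n z)) \<le> length v" "length (filter ?N (take n z)) \<le> length w"
      by simp_all
    then show "(case a of (z, n) \<Rightarrow> (length (filter P (take n z)), length (filter ?N (take n z)),
        take n z, drop n z)) \<in> ?B"
      unfolding a(1) by (simp add: partition_in_shuffles)
    show "(case case a of (z, n) \<Rightarrow> (length (filter P (take n z)), length (filter ?N (take n z)),
        take n z, drop n z) of (i, j, s, t) \<Rightarrow> (s @ t, length s)) = a"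
      using a by simp
    show "(case case a of (z, n) \<Rightarrow> (length (filter P (take n z)), length (filter ?N (take n z)),
        take n z, drop n z) of (i, j, s, t) \<Rightarrow> h s t) = (case a of (z, n) \<Rightarrow> h (take n z) (drop n z))"
      using a by simp
  next
    fix b assume "b \<in> ?B"
    then obtain i j s t where b: "b = (i, j, s, t)" "i \<le> length v" "j \<le> length w"
      "filter P s = take i v" "filter ?N s = take j w" "filter P t = drop i v" "filter ?N t = drop j w"
      using iff by auto
    show "(case b of (i, j, s, t) \<Rightarrow> (s @ t, length s)) \<in> ?A"
      using b by (simp add: iff)
    show "(case case b of (i, j, s, t) \<Rightarrow> (s @ t, length s) of (z, n) \<Rightarrow>
        (length (filter P (take n z)), length (filter ?N (take n z)), take n z, drop n z)) = b"
      using b by simp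
  qed
  then show ?thesis
    by (simp add: sum.Sigma sum.cartesian_product case_prod_beta)
qed

lemma PQ_mult_bvec:
  "PQ_mult (bvec (v, w)) =
     (\<Sum>z\<in>shifted_shuffle (Rep_colored_pf v) (Rep_colored_pf w). bvec (Abs_colored_pf z))"
proof -
  let ?S = "shifted_shuffle (Rep_colored_pf v) (Rep_colored_pf w)"
  have rep: "Rep_colored_pf (Abs_colored_pf z) = z" if "z \<in> ?S" for z
    using that by (intro Rep_Abs parking_shifted_shuffle[OF parking_Rep parking_Rep])
  have "(\<Sum>z | Rep_colored_pf z \<in> ?S. bvec z) = (\<Sum>z\<in>?S. bvec (Abs_colored_pf z))"
    by (rule sum.reindex_bij_witness[of _ Abs_colored_pf Rep_colored_pf])
      (simp_all add: rep Rep_colored_pf_inverse)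
  then show ?thesis by (simp add: PQ_mult_def)
qed

text \<open>On basis elements both sides range over prefix lengths \<open>i\<close>,
  \<open>j\<close> and a shuffle on each side of the cut. One side parkizes the shuffles, the other
  shuffles the parkized pieces; \<open>colored_park_shuffles\<close> identifies the two.\<close>

lemma PQ_comult_mult:
  fixes x y :: "colored_pf \<Rightarrow>\<^sub>0 'k::field"
  shows "PQ_comult (PQ_mult (tensor x y)) =
     tensor_map PQ_mult PQ_mult (middle_swap (tensor (PQ_comult x) (PQ_comult y)))"
proof -
  have swap: "flinear (middle_swap :: _ \<Rightarrow> ((colored_pf \<times> colored_pf) \<times> (colored_pf \<times> colored_pf) \<Rightarrow>\<^sub>0 'k))"
    by (simp add: middle_swap_def)
  show ?thesis
  proof (rule bilinear_eqI[of "\<lambda>x y. PQ_comult (PQ_mult (tensor x y))"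
        "\<lambda>x y. tensor_map PQ_mult PQ_mult (middle_swap (tensor (PQ_comult x) (PQ_comult y)))"])
    fix a b
    let ?v = "Rep_colored_pf a" and ?w = "Rep_colored_pf b"
    let ?B = "\<lambda>s t. bvec (Abs_colored_pf s, Abs_colored_pf t) :: colored_pf \<times> colored_pf \<Rightarrow>\<^sub>0 'k"
    let ?k = "length ?v"
    let ?a = "bvec a :: colored_pf \<Rightarrow>\<^sub>0 'k" and ?b = "bvec b :: colored_pf \<Rightarrow>\<^sub>0 'k"
    have comult: "PQ_comult (bvec (Abs_colored_pf z)) =
        (\<Sum>n\<le>length z. ?B (colored_park (take n z)) (colored_park (drop n z)))"
      if "z \<in> shifted_shuffle ?v ?w" for z
    proof -
      have z: "Rep_colored_pf (Abs_colored_pf z) = z"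
        using that by (intro Rep_Abs parking_shifted_shuffle[OF parking_Rep parking_Rep])
      have "park_take n (Abs_colored_pf z) = Abs_colored_pf (colored_park (take n z))"
        "park_drop n (Abs_colored_pf z) = Abs_colored_pf (colored_park (drop n z))" for n
        using park_take.rep_eq[of n "Abs_colored_pf z"] park_drop.rep_eq[of n "Abs_colored_pf z"]
        unfolding z by (metis Rep_colored_pf_inverse)+
      then show ?thesis by (simp add: PQ_comult_bvec z)
    qed
    have "\<forall>p\<in>set ?v. fst p \<le> ?k" using parking_le_length[OF parking_Rep, of _ a] by simp
    moreover have "\<forall>p\<in>set (shift ?k ?w). \<not> fst p \<le> ?k"
      using zero_notin_Rep[of b] by (force simp: shift_def)
    ultimately have split: "(\<Sum>z\<in>shuffles ?v (shift ?k ?w). \<Sum>n\<le>length z. h (take n z) (drop n z)) =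
        (\<Sum>i\<le>?k. \<Sum>j\<le>length ?w. \<Sum>s\<in>shuffles (take i ?v) (shift ?k (take j ?w)).
          \<Sum>t\<in>shuffles (drop i ?v) (shift ?k (drop j ?w)). h s t)"
      for h :: "_ \<Rightarrow> _ \<Rightarrow> colored_pf \<times> colored_pf \<Rightarrow>\<^sub>0 'k"
      by (subst sum_split_shuffles[where P = "\<lambda>p. fst p \<le> ?k"]) (simp_all add: take_shift drop_shift)
    note bij = sum.reindex_bij_betw[OF colored_park_shuffles[OF parking_Rep parking_Rep]]
    have "PQ_comult (PQ_mult (tensor ?a ?b)) = (\<Sum>z\<in>shuffles ?v (shift ?k ?w).
        \<Sum>n\<le>length z. ?B (colored_park (take n z)) (colored_park (drop n z)))"
      unfolding tensor_bvec PQ_mult_bvec flinear_sum[OF flinear_PQ_comult]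
      by (simp add: comult shifted_shuffle_def cong: sum.cong)
    also have "\<dots> = (\<Sum>i\<le>?k. \<Sum>j\<le>length ?w.
        \<Sum>s\<in>shuffles (take i ?v) (shift ?k (take j ?w)).
        \<Sum>t\<in>shuffles (drop i ?v) (shift ?k (drop j ?w)). ?B (colored_park s) (colored_park t))"
      by (rule split)
    also have "\<dots> = (\<Sum>i\<le>?k. \<Sum>j\<le>length ?w.
        \<Sum>s\<in>shifted_shuffle (colored_park (take i ?v)) (colored_park (take j ?w)).
        \<Sum>t\<in>shifted_shuffle (colored_park (drop i ?v)) (colored_park (drop j ?w)). ?B s t)"
    proof (rule sum.cong[OF refl], rule sum.cong[OF refl])
      fix i j
      have "(\<Sum>t\<in>shuffles (drop i ?v) (shift ?k (drop j ?w)). ?B s (colored_park t)) =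
          (\<Sum>t\<in>shifted_shuffle (colored_park (drop i ?v)) (colored_park (drop j ?w)). ?B s t)" for s
        by (rule bij[OF sub_mset_drop sub_mset_drop])
      then show "(\<Sum>s\<in>shuffles (take i ?v) (shift ?k (take j ?w)).
          \<Sum>t\<in>shuffles (drop i ?v) (shift ?k (drop j ?w)). ?B (colored_park s) (colored_park t)) =
          (\<Sum>s\<in>shifted_shuffle (colored_park (take i ?v)) (colored_park (take j ?w)).
          \<Sum>t\<in>shifted_shuffle (colored_park (drop i ?v)) (colored_park (drop j ?w)). ?B s t)"
        by (simp only:) (rule bij[OF sub_mset_take sub_mset_take])
    qed
    also have "\<dots> = (\<Sum>i\<le>?k. \<Sum>j\<le>length ?w. tensor (PQ_mult (bvec (park_take i a, park_take j b)))
        (PQ_mult (bvec (park_drop i a, park_drop j b))))"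
      by (simp add: PQ_mult_bvec park_take.rep_eq park_drop.rep_eq flinear_sum[OF flinear_tensor_left]
          flinear_sum[OF flinear_tensor_right])
        (subst sum.swap, rule refl)
    also have "\<dots> = tensor_map PQ_mult PQ_mult
        (middle_swap (tensor (PQ_comult ?a) (PQ_comult ?b)))"
    proof -
      have "middle_swap (tensor (PQ_comult ?a) (PQ_comult ?b)) =
          (\<Sum>i\<le>?k. \<Sum>j\<le>length ?w. bvec ((park_take i a, park_take j b), (park_drop i a, park_drop j b)))"
        by (simp add: PQ_comult_bvec flinear_sum[OF flinear_tensor_left]
            flinear_sum[OF flinear_tensor_right] flinear_sum[OF swap])
          (subst sum.swap, simp add: middle_swap_def)
      then show ?thesis
        by (simp add: flinear_sum[OF flinear_tensor_map] tensor_map_bvec)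
    qed
    finally show "PQ_comult (PQ_mult (tensor ?a ?b)) = tensor_map PQ_mult PQ_mult
        (middle_swap (tensor (PQ_comult ?a) (PQ_comult ?b)))" .
  qed (simp_all add: flinear_compose[OF flinear_PQ_comult] flinear_compose[OF flinear_PQ_mult]
      flinear_compose[OF swap])
qed

section \<open>Unit, counit and antipode\<close>

lemma PQ_comult_one: "PQ_comult PQ_one = tensor PQ_one PQ_one"
  by (simp add: PQ_one_def PQ_comult_bvec park_drop_0 park_take_all)

lemma PQ_counit_one: "PQ_counit PQ_one = 1"
  by (simp add: PQ_one_def PQ_counit_def)

lemma PQ_counit_mult: "PQ_counit (PQ_mult (tensor x y)) = PQ_counit x * PQ_counit y"
proof -
  have "breaks_pf empty_pf = {0}" using zero_mem_breaks[of empty_pf] by auto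
  then show ?thesis
    using high_pf_0[of empty_pf] low_pf_deg[of empty_pf] by (simp add: PQ_counit_def lookup_PQ_mult)
qed

lemma linear_PQ_counit: "Vector_Spaces.linear fscale (*) PQ_counit"
  unfolding Vector_Spaces.linear_iff
  using free_vs.vector_space_axioms
  by (simp add: PQ_counit_def lookup_add lookup_fscale vector_space_def algebra_simps)

lemma connected_bialgebra_PQ:
  "connected_bialgebra PQ_mult PQ_one PQ_comult PQ_counit deg_pf"
proof (rule connected_bialgebra.intro)
  fix a b c
  assume "(a, b) \<in> Poly_Mapping.keys (PQ_comult (bvec c))"
  then have "c \<in> splits a b" by (simp add: in_keys_iff lookup_PQ_comult_bvec split: if_splits)
  then show "deg_pf a + deg_pf b = deg_pf c" by (simp add: splits_def)
next
  show "deg_pf a = 0 \<Longrightarrow> bvec a = PQ_one" for a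
    unfolding deg_0_iff by (simp add: PQ_one_def)
qed (fact flinear_PQ_mult flinear_PQ_comult linear_PQ_counit PQ_mult_assoc PQ_unit_left PQ_unit_right
    PQ_coassoc PQ_counit_left PQ_counit_right PQ_counit_one)+

definition PQ_antipode :: "(colored_pf \<Rightarrow>\<^sub>0 'k::field) \<Rightarrow> (colored_pf \<Rightarrow>\<^sub>0 'k)" where
  "PQ_antipode = connected_bialgebra.antipode PQ_mult PQ_one PQ_comult PQ_counit deg_pf"

lemma hopf_algebra_PQ: "hopf_algebra PQ_mult PQ_one PQ_comult PQ_counit PQ_antipode"
proof -
  interpret PQ: connected_bialgebra PQ_mult PQ_one PQ_comult PQ_counit deg_pf
    by (rule connected_bialgebra_PQ)
  show ?thesis
    by (rule hopf_algebra.intro)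
      (unfold PQ_antipode_def, (fact flinear_PQ_mult flinear_PQ_comult linear_PQ_counit
        PQ.flinear_antipode PQ_mult_assoc PQ_unit_left PQ_unit_right PQ_coassoc PQ_counit_left
        PQ_counit_right PQ_comult_mult PQ_comult_one PQ_counit_mult PQ_counit_one
        PQ.antipode_conv_id[unfolded PQ.conv_def PQ.conv_one_def])+)
qed

section \<open>The subalgebra spanned by the signed nondecreasing parking functions\<close>

definition nondec_pf :: "colored_pf \<Rightarrow> colored_pf" where
  "nondec_pf w = Abs_colored_pf (nondec (Rep_colored_pf w))"

definition signed_ndpf_pf :: "colored_pf set" where
  "signed_ndpf_pf = {p. Rep_colored_pf p \<in> signed_ndpf}"

abbreviation PP_pf :: "colored_pf \<Rightarrow> (colored_pf \<Rightarrow>\<^sub>0 'k::field)" where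
  "PP_pf p \<equiv> PP (Rep_colored_pf p)"

lemma Rep_nondec_pf [simp]: "Rep_colored_pf (nondec_pf w) = nondec (Rep_colored_pf w)"
  unfolding nondec_pf_def
  using parking_cong_mset[OF mset_letters_cong[OF mset_nondec]] parking_Rep by (intro Rep_Abs) blast

lemma nondec_pf_in_signed_ndpf_pf: "nondec_pf w \<in> signed_ndpf_pf \<longleftrightarrow> signed (Rep_colored_pf w)"
  by (simp add: signed_ndpf_pf_def nondec_in_signed_ndpf)

lemma nondec_pf_id: "p \<in> signed_ndpf_pf \<Longrightarrow> nondec_pf p = p"
  by (rule colored_pf_eqI) (simp add: signed_ndpf_pf_def nondec_eq_iff)

lemma nondec_pf_cong:
  assumes "mset (Rep_colored_pf v) = mset (Rep_colored_pf w)" "signed (Rep_colored_pf w)"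
  shows "nondec_pf v = nondec_pf w"
  by (rule colored_pf_eqI) (simp add: nondec_eq_iff nondec_in_signed_ndpf assms)

lemma lookup_PP: "Poly_Mapping.lookup (PP \<pi>) w = (if nondec (Rep_colored_pf w) = \<pi> then 1 else 0)"
proof -
  have "{w. nondec (Rep_colored_pf w) = \<pi>} \<subseteq> {w. deg_pf w = length \<pi>}"
    by (auto simp: nondec_def)
  then have "finite {w. nondec (Rep_colored_pf w) = \<pi>}"
    by (rule finite_subset) (rule finite_deg)
  then show ?thesis
    by (simp add: PP_def lookup_sum lookup_single when_def)
qed

lemma lookup_PP_pf: "Poly_Mapping.lookup (PP_pf p) w = (if nondec_pf w = p then 1 else 0)"
  by (simp add: lookup_PP Rep_colored_pf_inject[symmetric])

lemma signed_ndpf_image: "signed_ndpf = Rep_colored_pf ` signed_ndpf_pf"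
proof (intro equalityI subsetI)
  fix \<pi> assume "\<pi> \<in> signed_ndpf"
  moreover from this have "Rep_colored_pf (Abs_colored_pf \<pi>) = \<pi>"
    by (intro Rep_Abs) (simp add: signed_ndpf_eq signed_def)
  ultimately show "\<pi> \<in> Rep_colored_pf ` signed_ndpf_pf"
    unfolding signed_ndpf_pf_def by (metis image_eqI mem_Collect_eq)
qed (auto simp: signed_ndpf_pf_def)

lemma PP_image: "PP ` signed_ndpf = PP_pf ` signed_ndpf_pf"
  by (simp add: signed_ndpf_image image_image)

lemma inj_on_PP: "inj_on PP signed_ndpf"
  using independent_fibre_sums(1)[of signed_ndpf_pf PP_pf nondec_pf, OF lookup_PP_pf nondec_pf_id]
  by (auto simp: signed_ndpf_image inj_on_def Rep_colored_pf_inject)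

lemma independent_PP: "\<not> module.dependent fscale (PP ` signed_ndpf)"
  unfolding PP_image
  by (rule independent_fibre_sums(2)[of signed_ndpf_pf PP_pf nondec_pf, OF lookup_PP_pf nondec_pf_id])

lemma NCPQSym2_eq: "NCPQSym2 = {x. \<forall>w. Poly_Mapping.lookup x w =
    (if signed (Rep_colored_pf w) then Poly_Mapping.lookup x (nondec_pf w) else 0)}"
  unfolding NCPQSym2_def PP_image nondec_pf_in_signed_ndpf_pf[symmetric]
  by (rule span_fibre_sums[OF lookup_PP_pf nondec_pf_id])

lemma NCPQSym2_I:
  assumes "\<And>w. \<not> signed (Rep_colored_pf w) \<Longrightarrow> Poly_Mapping.lookup x w = 0"
    and "\<And>v w. mset (Rep_colored_pf v) = mset (Rep_colored_pf w) \<Longrightarrow>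
      Poly_Mapping.lookup x v = Poly_Mapping.lookup x w"
  shows "x \<in> NCPQSym2"
  unfolding NCPQSym2_eq using assms(1) assms(2)[of "nondec_pf w" w for w] by auto

lemma NCPQSym2D:
  "x \<in> NCPQSym2 \<Longrightarrow> Poly_Mapping.lookup x w =
    (if signed (Rep_colored_pf w) then Poly_Mapping.lookup x (nondec_pf w) else 0)"
  unfolding NCPQSym2_eq by (drule CollectD) (erule spec)

lemma NCPQSym2_not_signed:
  "x \<in> NCPQSym2 \<Longrightarrow> \<not> signed (Rep_colored_pf w) \<Longrightarrow> Poly_Mapping.lookup x w = 0"
  by (subst NCPQSym2D) simp_all

lemma NCPQSym2_cong:
  assumes x: "x \<in> NCPQSym2" and eq: "mset (Rep_colored_pf v) = mset (Rep_colored_pf w)"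
  shows "Poly_Mapping.lookup x v = Poly_Mapping.lookup x w"
proof (cases "signed (Rep_colored_pf w)")
  case True
  moreover have "signed (Rep_colored_pf v)" using True signed_cong_mset[OF eq] by simp
  moreover have "Poly_Mapping.lookup x u = Poly_Mapping.lookup x (nondec_pf u)"
    if "signed (Rep_colored_pf u)" for u
    using that by (subst NCPQSym2D[OF x]) simp
  ultimately show ?thesis using nondec_pf_cong[OF eq True] by metis
next
  case False
  then show ?thesis using NCPQSym2_not_signed[OF x] signed_cong_mset[OF eq] by simp
qed

section \<open>Closure properties\<close>

lemma one_in_NCPQSym2: "PQ_one \<in> NCPQSym2"
proof (rule NCPQSym2_I)
  fix v w assume "mset (Rep_colored_pf v) = mset (Rep_colored_pf w)"
  then have "deg_pf v = deg_pf w" by (metis size_mset)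
  then have "v = empty_pf \<longleftrightarrow> w = empty_pf" by (simp add: deg_0_iff[symmetric] del: length_0_conv)
  then show "Poly_Mapping.lookup PQ_one v = Poly_Mapping.lookup PQ_one w"
    by (auto simp: PQ_one_def lookup_single when_def)
next
  fix w assume "\<not> signed (Rep_colored_pf w)"
  moreover have "signed (Rep_colored_pf empty_pf)"
    using parking_Rep[of empty_pf] by (simp add: signed_def empty_pf.rep_eq)
  ultimately show "Poly_Mapping.lookup PQ_one w = 0"
    by (auto simp: PQ_one_def lookup_single when_def)
qed

text \<open>By \<open>signed_of_low_high\<close>, at each breakpoint of a word that is not signed
  one of the two parts is not signed, so every term vanishes. Words with equal multisets of
  biletters have the same breakpoints, and their parts again have equal multisets.\<close>

lemma mult_in_NCPQSym2:
  assumes x: "x \<in> NCPQSym2" and y: "y \<in> NCPQSym2"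
  shows "PQ_mult (tensor x y) \<in> NCPQSym2"
proof (rule NCPQSym2_I)
  fix w assume w: "\<not> signed (Rep_colored_pf w)"
  have "Poly_Mapping.lookup x (low_pf k w) * Poly_Mapping.lookup y (high_pf k w) = 0"
    if "k \<in> breaks_pf w" for k
    using signed_of_low_high[OF parking_Rep that] w NCPQSym2_not_signed[OF x, of "low_pf k w"]
      NCPQSym2_not_signed[OF y, of "high_pf k w"]
    by (auto simp: Rep_low_pf[OF that] Rep_high_pf[OF that])
  then show "Poly_Mapping.lookup (PQ_mult (tensor x y)) w = 0"
    unfolding lookup_PQ_mult lookup_tensor by (intro sum.neutral) blast
next
  fix v w assume eq: "mset (Rep_colored_pf v) = mset (Rep_colored_pf w)"
  have brk: "breaks_pf v = breaks_pf w"
    using cnt_cong_mset[OF mset_letters_cong[OF eq]] mset_eq_length[OF eq] by simp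
  show "Poly_Mapping.lookup (PQ_mult (tensor x y)) v = Poly_Mapping.lookup (PQ_mult (tensor x y)) w"
    unfolding lookup_PQ_mult lookup_tensor
  proof (rule sum.cong[OF brk])
    fix k assume k: "k \<in> breaks_pf w"
    then have k': "k \<in> breaks_pf v" unfolding brk .
    have "Poly_Mapping.lookup x (low_pf k v) = Poly_Mapping.lookup x (low_pf k w)"
      by (rule NCPQSym2_cong[OF x])
        (simp only: Rep_low_pf[OF k] Rep_low_pf[OF k'] low_def mset_filter eq)
    moreover have "Poly_Mapping.lookup y (high_pf k v) = Poly_Mapping.lookup y (high_pf k w)"
      by (rule NCPQSym2_cong[OF y])
        (simp only: Rep_high_pf[OF k] Rep_high_pf[OF k'] high_def mset_filter mset_map eq)
    ultimately show "Poly_Mapping.lookup x (low_pf k v) * Poly_Mapping.lookup y (high_pf k v) =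
        Poly_Mapping.lookup x (low_pf k w) * Poly_Mapping.lookup y (high_pf k w)" by simp
  qed
qed

text \<open>The coefficient of \<open>p \<otimes> q\<close> in a coproduct is a sum over words \<open>s \<cdot> t\<close> with \<open>Park(s) = p\<close> and
  \<open>Park(t) = q\<close>. Exchanging \<open>s\<close> and \<open>t\<close>, or permuting the letters of \<open>s\<close>, does not change the
  coefficient of \<open>s \<cdot> t\<close> in an element of the subalgebra.\<close>

definition rearrange :: "(colored_word \<Rightarrow> colored_word) \<Rightarrow> colored_pf \<Rightarrow> colored_pf" where
  "rearrange f w = Abs_colored_pf (f (Rep_colored_pf w))"

lemma Rep_rearrange:
  assumes "\<And>w. mset (f w) = mset w"
  shows "Rep_colored_pf (rearrange f w) = f (Rep_colored_pf w)"
  unfolding rearrange_def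
  using parking_cong_mset[OF mset_letters_cong[OF assms]] parking_Rep by (intro Rep_Abs) blast

lemma splits_iff:
  "w \<in> splits p q \<longleftrightarrow> deg_pf w = deg_pf p + deg_pf q \<and>
     colored_park (take (deg_pf p) (Rep_colored_pf w)) = Rep_colored_pf p \<and>
     colored_park (drop (deg_pf p) (Rep_colored_pf w)) = Rep_colored_pf q"
  by (simp add: splits_def Rep_colored_pf_inject[symmetric] park_take.rep_eq park_drop.rep_eq)

lemma sum_splits_rearrange:
  assumes x: "x \<in> NCPQSym2"
    and f: "\<And>w. mset (f w) = mset w" and g: "\<And>w. mset (g w) = mset w"
    and fg: "\<And>w. w \<in> splits p q \<Longrightarrow> rearrange f w \<in> splits p' q' \<and> g (f (Rep_colored_pf w)) = Rep_colored_pf w"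
    and gf: "\<And>w. w \<in> splits p' q' \<Longrightarrow> rearrange g w \<in> splits p q \<and> f (g (Rep_colored_pf w)) = Rep_colored_pf w"
  shows "Poly_Mapping.lookup (PQ_comult x) (p, q) = Poly_Mapping.lookup (PQ_comult x) (p', q')"
  unfolding lookup_PQ_comult
proof (rule sum.reindex_bij_witness[of _ "rearrange g" "rearrange f"])
  fix w assume w: "w \<in> splits p q"
  show "rearrange g (rearrange f w) = w"
    using fg[OF w] by (intro colored_pf_eqI) (simp add: Rep_rearrange f g)
  show "rearrange f w \<in> splits p' q'" using fg[OF w] by simp
  show "Poly_Mapping.lookup x (rearrange f w) = Poly_Mapping.lookup x w"
    by (rule NCPQSym2_cong[OF x]) (simp add: Rep_rearrange f)
next
  fix w assume w: "w \<in> splits p' q'"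
  show "rearrange f (rearrange g w) = w"
    using gf[OF w] by (intro colored_pf_eqI) (simp add: Rep_rearrange f g)
  show "rearrange g w \<in> splits p q" using gf[OF w] by simp
qed

lemma lookup_PQ_comult_swap:
  assumes "x \<in> NCPQSym2"
  shows "Poly_Mapping.lookup (PQ_comult x) (p, q) = Poly_Mapping.lookup (PQ_comult x) (q, p)"
proof -
  let ?f = "\<lambda>k w :: colored_word. drop k w @ take k w"
  have mset: "mset (?f k w) = mset w" for k w
    by (metis append_take_drop_id mset_append union_commute)
  have rep: "Rep_colored_pf (rearrange (?f k) w) = ?f k (Rep_colored_pf w)" for k w
    by (rule Rep_rearrange) (rule mset)
  have "rearrange (?f (deg_pf p)) w \<in> splits q p \<and>
      ?f (deg_pf q) (?f (deg_pf p) (Rep_colored_pf w)) = Rep_colored_pf w"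
    if "w \<in> splits p q" for w p q
    using that by (simp add: splits_iff rep)
  then show ?thesis
    by (intro sum_splits_rearrange[where f = "?f (deg_pf p)" and g = "?f (deg_pf q)", OF assms]
        mset)
qed

lemma lookup_PQ_comult_permute:
  assumes x: "x \<in> NCPQSym2" and eq: "mset (Rep_colored_pf p) = mset (Rep_colored_pf p')"
  shows "Poly_Mapping.lookup (PQ_comult x) (p, q) = Poly_Mapping.lookup (PQ_comult x) (p', q)"
proof -
  obtain \<sigma> where \<sigma>: "\<sigma> permutes {..<deg_pf p}"
    "permute_list \<sigma> (Rep_colored_pf p) = Rep_colored_pf p'"
    using mset_eq_permutation[OF eq[symmetric]] by (metis length_permute_list)
  have len: "deg_pf p' = deg_pf p" using mset_eq_length[OF eq] by simp
  have inv_\<sigma>: "inv \<sigma> permutes {..<deg_pf p}" using \<sigma>(1) by (rule permutes_inv)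
  have cancel: "permute_list (inv \<sigma>) (permute_list \<sigma> w) = w"
    "permute_list \<sigma> (permute_list (inv \<sigma>) w) = w" if "length w = deg_pf p" for w :: colored_word
    using that \<sigma>(1) inv_\<sigma> permutes_inv_o[OF \<sigma>(1)]
    by (simp_all flip: permute_list_compose)
  \<comment> \<open>A permutation of the first \<open>deg_pf p\<close> positions makes sense only
    for words of at least that length. The identity elsewhere keeps the multiset fixed on all words,
    as \<open>Rep_rearrange\<close> demands.\<close>
  let ?f = "\<lambda>\<sigma> w :: colored_word. if deg_pf p \<le> length w
    then permute_list \<sigma> (take (deg_pf p) w) @ drop (deg_pf p) w else w"
  have mset: "mset (?f \<tau> w) = mset w" if "\<tau> permutes {..<deg_pf p}" for \<tau> w
  proof (cases "deg_pf p \<le> length w")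
    case True
    then have "mset (permute_list \<tau> (take (deg_pf p) w)) = mset (take (deg_pf p) w)"
      using that by (simp add: min_absorb2)
    then have "mset (?f \<tau> w) = mset (take (deg_pf p) w @ drop (deg_pf p) w)"
      using True by (simp only: if_True mset_append)
    then show ?thesis by (simp only: append_take_drop_id)
  qed simp
  have park: "colored_park (permute_list \<tau> (take (deg_pf p) (Rep_colored_pf w))) =
      permute_list \<tau> (colored_park (take (deg_pf p) (Rep_colored_pf w)))"
    if "\<tau> permutes {..<deg_pf p}" "deg_pf p \<le> deg_pf w" for \<tau> w
    by (rule colored_park_permute[OF zero_notin_take]) (use that in \<open>simp add: min_absorb2\<close>)
  have rep: "Rep_colored_pf (rearrange (?f \<tau>) w) = ?f \<tau> (Rep_colored_pf w)"
    if "\<tau> permutes {..<deg_pf p}" for \<tau> w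
    by (rule Rep_rearrange) (rule mset[OF that])
  show ?thesis
  proof (rule sum_splits_rearrange[where f = "?f \<sigma>" and g = "?f (inv \<sigma>)", OF x])
    show "mset (?f \<sigma> w) = mset w" "mset (?f (inv \<sigma>) w) = mset w" for w
      by (rule mset[OF \<sigma>(1)], rule mset[OF inv_\<sigma>])
  next
    fix w assume w: "w \<in> splits p q"
    then have "rearrange (?f \<sigma>) w \<in> splits p' q"
      unfolding splits_iff rep[OF \<sigma>(1)] by (simp add: len park \<sigma>)
    moreover have "?f (inv \<sigma>) (?f \<sigma> (Rep_colored_pf w)) = Rep_colored_pf w"
      using w by (simp add: splits_iff cancel)
    ultimately show "rearrange (?f \<sigma>) w \<in> splits p' q \<and>
        ?f (inv \<sigma>) (?f \<sigma> (Rep_colored_pf w)) = Rep_colored_pf w" by blast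
  next
    fix w assume w: "w \<in> splits p' q"
    have "permute_list (inv \<sigma>) (Rep_colored_pf p') = Rep_colored_pf p"
      using cancel(1)[of "Rep_colored_pf p"] by (simp add: \<sigma>(2))
    then have "rearrange (?f (inv \<sigma>)) w \<in> splits p q"
      using w unfolding splits_iff rep[OF inv_\<sigma>] by (simp add: len park inv_\<sigma>)
    moreover have "?f \<sigma> (?f (inv \<sigma>) (Rep_colored_pf w)) = Rep_colored_pf w"
      using w by (simp add: splits_iff cancel len)
    ultimately show "rearrange (?f (inv \<sigma>)) w \<in> splits p q \<and>
        ?f \<sigma> (?f (inv \<sigma>) (Rep_colored_pf w)) = Rep_colored_pf w" by blast
  qed
qed

text \<open>A prefix of a signed word parkizes to a signed word. The corresponding fact for the
  right factor \<open>q\<close> comes from the symmetry of the coefficients.\<close>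

lemma lookup_PQ_comult_not_signed:
  assumes x: "x \<in> NCPQSym2" and "\<not> signed (Rep_colored_pf p)"
  shows "Poly_Mapping.lookup (PQ_comult x) (p, q) = 0"
  unfolding lookup_PQ_comult
proof (rule sum.neutral, intro ballI)
  fix w assume "w \<in> splits p q"
  then have "colored_park (take (deg_pf p) (Rep_colored_pf w)) = Rep_colored_pf p"
    by (simp add: splits_iff)
  then have "\<not> signed (Rep_colored_pf w)"
    using signed_colored_park[OF _ sub_mset_take] assms(2) by metis
  then show "Poly_Mapping.lookup x w = 0" by (rule NCPQSym2_not_signed[OF x])
qed

text \<open>The coefficients of the coproduct satisfy the description of the span of all
  \<open>tensor (PP_pf p) (PP_pf q)\<close>. Vanishing and invariance are known in the left
  component and transferred to the right one by symmetry.\<close>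

lemma comult_in_NCPQSym2:
  fixes x :: "colored_pf \<Rightarrow>\<^sub>0 'k::field"
  assumes x: "x \<in> NCPQSym2"
  shows "PQ_comult x \<in> module.span fscale {tensor y z |y z. y \<in> NCPQSym2 \<and> z \<in> NCPQSym2}"
proof -
  let ?D = "PQ_comult x" and ?r = "map_prod nondec_pf nondec_pf"
  let ?G = "signed_ndpf_pf \<times> signed_ndpf_pf"
  let ?PP = "\<lambda>(p, q). tensor (PP_pf p) (PP_pf q) :: colored_pf \<times> colored_pf \<Rightarrow>\<^sub>0 'k"
  have span: "free_vs.span (?PP ` ?G) = {y. \<forall>w. Poly_Mapping.lookup y w =
      (if ?r w \<in> ?G then Poly_Mapping.lookup y (?r w) else 0)}"
  proof (rule span_fibre_sums)
    show "Poly_Mapping.lookup (?PP p) w = (if ?r w = p then 1 else 0)" for p w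
      by (cases p; cases w) (auto simp: lookup_PP_pf)
    show "?r p = p" if "p \<in> ?G" for p
      using that by (auto simp: nondec_pf_id)
  qed
  have nondec: "Poly_Mapping.lookup ?D (nondec_pf p, q) = Poly_Mapping.lookup ?D (p, q)"
    "Poly_Mapping.lookup ?D (q, nondec_pf p) = Poly_Mapping.lookup ?D (q, p)" for p q
    using lookup_PQ_comult_permute[OF x, of "nondec_pf p" p q] lookup_PQ_comult_swap[OF x]
    by simp_all
  have D: "Poly_Mapping.lookup ?D (p, q) =
      (if ?r (p, q) \<in> ?G then Poly_Mapping.lookup ?D (?r (p, q)) else 0)" for p q
    using lookup_PQ_comult_not_signed[OF x, of p q] lookup_PQ_comult_not_signed[OF x, of q p]
      lookup_PQ_comult_swap[OF x, of p q]
    by (auto simp: nondec_pf_in_signed_ndpf_pf nondec)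
  have "?D \<in> free_vs.span (?PP ` ?G)"
    unfolding span
    by (intro CollectI allI) (rule D[of "fst w" "snd w" for w, unfolded prod.collapse])
  moreover have "PP_pf p \<in> NCPQSym2" if "p \<in> signed_ndpf_pf" for p
    unfolding NCPQSym2_def PP_image using that by (intro free_vs.span_base imageI)
  then have "?PP ` ?G \<subseteq> {tensor y z |y z. y \<in> NCPQSym2 \<and> z \<in> NCPQSym2}"
    by auto
  ultimately show ?thesis
    by (rule subsetD[OF free_vs.span_mono, rotated])
qed

section \<open>Cocommutativity and the final assembly\<close>

lemma lookup_twist: "Poly_Mapping.lookup (twist x) (b, a) = Poly_Mapping.lookup x (a, b)"
proof -
  have "Poly_Mapping.lookup (twist x) (b, a) =
      (\<Sum>p\<in>Poly_Mapping.keys x. if p = (a, b) then Poly_Mapping.lookup x p else 0)"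
    unfolding twist_def lookup_lin_ext
    by (intro sum.cong) (auto simp: lookup_single when_def split: prod.splits)
  then show ?thesis by (simp add: in_keys_iff)
qed

lemma cocommutative_NCPQSym2: "cocommutative_on PQ_comult NCPQSym2"
  unfolding cocommutative_on_def
proof (intro ballI poly_mapping_eqI)
  fix x :: "colored_pf \<Rightarrow>\<^sub>0 'a" and w
  assume "x \<in> NCPQSym2"
  then show "Poly_Mapping.lookup (twist (PQ_comult x)) w = Poly_Mapping.lookup (PQ_comult x) w"
    by (cases w) (simp only: lookup_twist, rule lookup_PQ_comult_swap)
qed

lemma hopf_subalgebra_NCPQSym2:
  "hopf_subalgebra PQ_mult PQ_one PQ_comult PQ_counit PQ_antipode
    (NCPQSym2 :: (colored_pf \<Rightarrow>\<^sub>0 'k::field) set)"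
proof -
  interpret PQ: connected_bialgebra "PQ_mult :: _ \<Rightarrow> (colored_pf \<Rightarrow>\<^sub>0 'k)" PQ_one PQ_comult
      PQ_counit deg_pf
    by (rule connected_bialgebra_PQ)
  have subspace: "module.subspace fscale (NCPQSym2 :: (colored_pf \<Rightarrow>\<^sub>0 'k) set)"
    unfolding NCPQSym2_def by (rule free_vs.subspace_span)
  show ?thesis
    unfolding hopf_subalgebra_def
  proof (intro conjI ballI)
    show "PQ_antipode x \<in> NCPQSym2" if "x \<in> NCPQSym2" for x :: "colored_pf \<Rightarrow>\<^sub>0 'k"
      unfolding PQ_antipode_def
      using subspace one_in_NCPQSym2 mult_in_NCPQSym2 comult_in_NCPQSym2 that
      by (rule PQ.antipode_mem)
  qed (fact hopf_algebra_PQ subspace one_in_NCPQSym2 | erule (1) mult_in_NCPQSym2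
      | erule comult_in_NCPQSym2)+
qed

text \<open>Injectivity accompanies independence of the image set so that the family itself, without
  repetitions, is a basis.\<close>

theorem theorem8p2:
  shows "inj_on (PP :: colored_word \<Rightarrow> (colored_pf \<Rightarrow>\<^sub>0 'k::field)) signed_ndpf
    \<and> \<not> module.dependent fscale ((PP :: colored_word \<Rightarrow> (colored_pf \<Rightarrow>\<^sub>0 'k)) ` signed_ndpf)
    \<and> module.span fscale ((PP :: colored_word \<Rightarrow> (colored_pf \<Rightarrow>\<^sub>0 'k)) ` signed_ndpf) = NCPQSym2
    \<and> (\<exists>S :: (colored_pf \<Rightarrow>\<^sub>0 'k) \<Rightarrow> (colored_pf \<Rightarrow>\<^sub>0 'k).
         hopf_subalgebra PQ_mult PQ_one PQ_comult PQ_counit S NCPQSym2)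
    \<and> cocommutative_on PQ_comult (NCPQSym2 :: (colored_pf \<Rightarrow>\<^sub>0 'k) set)"
  using inj_on_PP independent_PP NCPQSym2_def[symmetric] hopf_subalgebra_NCPQSym2
    cocommutative_NCPQSym2 by blast

end
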